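(* Let $X(\mathbb{R}^n)$ be a Banach function space satisfying the weak doubling property. If $\sigma\in\mathbb{R}$ and $a\in\mathcal{M}_{X(\mathbb{R}^n)}\cap L_{1,\sigma}(\mathbb{R}^n)$, then $a\in L^\infty(\mathbb{R}^n)$ and $\|a\|_{L^\infty(\mathbb{R}^n)}\le\|a\|_{\mathcal{M}_{X(\mathbb{R}^n)}}$.
   Context: Banach function spaces: let $\mathfrak{M}^+(\mathbb{R}^n)$ be the set of Lebesgue measurable functions on $\mathbb{R}^n$ with values in $[0,\infty]$. A Banach function norm is a map $\rho:\mathfrak{M}^+(\mathbb{R}^n)\to[0,\infty]$ such that for all $f,g,f_j\in\mathfrak{M}^+(\mathbb{R}^n)$, all constants $a\ge0$ and all measurable $E\subset\mathbb{R}^n$: (A1) $\rho(f)=0\iff f=0$ a.e., $\rho(af)=a\rho(f)$, $\rho(f+g)\le\rho(f)+\rho(g)$; (A2) $0\le g\le f$ a.e. implies $\rho(g)\le\rho(f)$; (A3) $0\le f_j\uparrow f$ a.e. implies $\rho(f_j)\uparrow\rho(f)$; (A4) $|E|<\infty$ implies $\rho(\chi_E)<\infty$; (A5) $|E|<\infty$ implies $\int_E f\,dx\le C_E\rho(f)$ with $C_E\in(0,\infty)$ independent of $f$. The Banach function space $X(\mathbb{R}^n)$ is the set of measurable complex-valued $f$ with $\rho(|f|)<\infty$ (a.e.-equal functions identified), normed by $\|f\|_{X(\mathbb{R}^n)}=\rho(|f|)$. $B(y,R)$ is the open ball of radius $R$ centered at $y$. Weak doubling property: there is $\tau>1$ with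 $\liminf_{R\to\infty}\big(\inf_{y\in\mathbb{R}^n}\|\chi_{B(y,\tau R)}\|_{X(\mathbb{R}^n)}/\|\chi_{B(y,R)}\|_{X(\mathbb{R}^n)}\big)<\infty$. $L_{1,\sigma}(\mathbb{R}^n)$ is the set of measurable $f$ with $\int_{\mathbb{R}^n}(1+|\xi|)^{-\sigma}|f(\xi)|\,d\xi<\infty$ (such $f$ are regarded as tempered distributions). Fourier multipliers: $(Fu)(\xi)=\int_{\mathbb{R}^n}u(x)e^{-ix\xi}dx$ on $S(\mathbb{R}^n)$, extended to $S'(\mathbb{R}^n)$. $\mathcal{M}_{X(\mathbb{R}^n)}$ is the set of $a\in S'(\mathbb{R}^n)$ with $\|a\|_{\mathcal{M}_{X(\mathbb{R}^n)}}:=\sup\{\|F^{-1}aFu\|_{X(\mathbb{R}^n)}/\|u\|_{X(\mathbb{R}^n)}: u\in (S(\mathbb{R}^n)\cap X(\mathbb{R}^n))\setminus\{0\}\}<\infty$. *)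

theory Defs
  imports "HOL-Analysis.Analysis" "HOL-Probability.Essential_Supremum"
begin

definition banach_function_norm :: "(('a::euclidean_space \<Rightarrow> ennreal) \<Rightarrow> ennreal) \<Rightarrow> bool" where
  "banach_function_norm rho \<longleftrightarrow>
     \<comment> \<open>(A1)\<close>
     (\<forall>f \<in> borel_measurable lebesgue. rho f = 0 \<longleftrightarrow> (AE x in lebesgue. f x = 0)) \<and>
     (\<forall>f \<in> borel_measurable lebesgue. \<forall>c::real. c \<ge> 0 \<longrightarrow>
        rho (\<lambda>x. ennreal c * f x) = ennreal c * rho f) \<and>
     (\<forall>f \<in> borel_measurable lebesgue. \<forall>g \<in> borel_measurable lebesgue.
        rho (\<lambda>x. f x + g x) \<le> rho f + rho g) \<and>
     \<comment> \<open>(A2)\<close>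
     (\<forall>f \<in> borel_measurable lebesgue. \<forall>g \<in> borel_measurable lebesgue.
        (AE x in lebesgue. g x \<le> f x) \<longrightarrow> rho g \<le> rho f) \<and>
     \<comment> \<open>(A3)\<close>
     (\<forall>fs f. (\<forall>j. fs j \<in> borel_measurable lebesgue) \<longrightarrow> f \<in> borel_measurable lebesgue \<longrightarrow>
        (AE x in lebesgue. incseq (\<lambda>j. fs j x) \<and> (\<lambda>j. fs j x) \<longlonglongrightarrow> f x) \<longrightarrow>
        incseq (\<lambda>j. rho (fs j)) \<and> (\<lambda>j. rho (fs j)) \<longlonglongrightarrow> rho f) \<and>
     \<comment> \<open>(A4)\<close>
     (\<forall>E \<in> sets lebesgue. emeasure lebesgue E < \<infinity> \<longrightarrow> rho (indicator E) < \<infinity>) \<and>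
     \<comment> \<open>(A5)\<close>
     (\<forall>E \<in> sets lebesgue. emeasure lebesgue E < \<infinity> \<longrightarrow>
        (\<exists>C::real. 0 < C \<and> (\<forall>f \<in> borel_measurable lebesgue.
            (\<integral>\<^sup>+ x\<in>E. f x \<partial>lebesgue) \<le> ennreal C * rho f)))"

definition Xnorm :: "(('a::euclidean_space \<Rightarrow> ennreal) \<Rightarrow> ennreal) \<Rightarrow> ('a \<Rightarrow> complex) \<Rightarrow> ennreal" where
  "Xnorm rho f = rho (\<lambda>x. ennreal (cmod (f x)))"

definition in_X :: "(('a::euclidean_space \<Rightarrow> ennreal) \<Rightarrow> ennreal) \<Rightarrow> ('a \<Rightarrow> complex) \<Rightarrow> bool" where
  "in_X rho f \<longleftrightarrow> f \<in> borel_measurable lebesgue \<and> Xnorm rho f < \<infinity>"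

definition weak_doubling :: "(('a::euclidean_space \<Rightarrow> ennreal) \<Rightarrow> ennreal) \<Rightarrow> bool" where
  "weak_doubling rho \<longleftrightarrow> (\<exists>\<tau>::real. \<tau> > 1 \<and>
     Liminf at_top (\<lambda>R::real. INF y. rho (indicator (ball y (\<tau> * R))) / rho (indicator (ball y R))) < \<infinity>)"

definition L1_sigma :: "real \<Rightarrow> ('a::euclidean_space \<Rightarrow> complex) set" where
  "L1_sigma \<sigma> = {f. f \<in> borel_measurable lebesgue \<and>
     (\<integral>\<^sup>+ \<xi>. ennreal ((1 + norm \<xi>) powr (-\<sigma>) * cmod (f \<xi>)) \<partial>lebesgue) < \<infinity>}"

definition partial_deriv :: "'a::euclidean_space \<Rightarrow> ('a \<Rightarrow> complex) \<Rightarrow> 'a \<Rightarrow> complex" where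
  "partial_deriv b f x = vector_derivative (\<lambda>t::real. f (x + t *\<^sub>R b)) (at 0)"

fun iter_deriv :: "'a::euclidean_space list \<Rightarrow> ('a \<Rightarrow> complex) \<Rightarrow> 'a \<Rightarrow> complex" where
  "iter_deriv [] f = f"
| "iter_deriv (b # bs) f = partial_deriv b (iter_deriv bs f)"

text \<open>Schwartz space: all iterated partial derivatives exist everywhere and
  x-polynomially weighted they are bounded (this forces C-infinity).\<close>
definition schwartz :: "('a::euclidean_space \<Rightarrow> complex) \<Rightarrow> bool" where
  "schwartz f \<longleftrightarrow> (\<forall>bs. set bs \<subseteq> Basis \<longrightarrow>
      (\<forall>b\<in>Basis. \<forall>x. (\<lambda>t::real. iter_deriv bs f (x + t *\<^sub>R b)) differentiable (at 0)) \<and>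
      (\<forall>k::nat. \<exists>C. \<forall>x. norm x ^ k * cmod (iter_deriv bs f x) \<le> C))"

definition test_function :: "('a::euclidean_space \<Rightarrow> complex) \<Rightarrow> bool" where
  "test_function \<phi> \<longleftrightarrow> schwartz \<phi> \<and> bounded {x. \<phi> x \<noteq> 0}"

definition fourier :: "('a::euclidean_space \<Rightarrow> complex) \<Rightarrow> 'a \<Rightarrow> complex" where
  "fourier u \<xi> = (\<integral>x. u x * cis (- (x \<bullet> \<xi>)) \<partial>lebesgue)"

definition inv_fourier :: "('a::euclidean_space \<Rightarrow> complex) \<Rightarrow> 'a \<Rightarrow> complex" where
  "inv_fourier \<phi> x = complex_of_real ((2 * pi) powr (- real DIM('a))) *
       (\<integral>\<xi>. \<phi> \<xi> * cis (x \<bullet> \<xi>) \<partial>lebesgue)"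

text \<open>The tempered distribution F^{-1} a F u (a a function in some L_{1,sigma}),
  evaluated at a test function phi: (F^{-1} T)(phi) = T(F^{-1} phi).\<close>
definition mult_op_distr :: "('a::euclidean_space \<Rightarrow> complex) \<Rightarrow> ('a \<Rightarrow> complex) \<Rightarrow> ('a \<Rightarrow> complex) \<Rightarrow> complex" where
  "mult_op_distr a u \<phi> = (\<integral>\<xi>. a \<xi> * fourier u \<xi> * inv_fourier \<phi> \<xi> \<partial>lebesgue)"

definition represents :: "('a::euclidean_space \<Rightarrow> complex) \<Rightarrow> (('a \<Rightarrow> complex) \<Rightarrow> complex) \<Rightarrow> bool" where
  "represents g T \<longleftrightarrow> g \<in> borel_measurable lebesgue \<and>
     (\<forall>\<phi>. test_function \<phi> \<longrightarrow> integrable lebesgue (\<lambda>x. g x * \<phi> x) \<and>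
        (\<integral>x. g x * \<phi> x \<partial>lebesgue) = T \<phi>)"

text \<open>X-norm of a distribution: the X-norm of a representing function; infinity if none.\<close>
definition distr_Xnorm :: "(('a::euclidean_space \<Rightarrow> ennreal) \<Rightarrow> ennreal) \<Rightarrow> (('a \<Rightarrow> complex) \<Rightarrow> complex) \<Rightarrow> ennreal" where
  "distr_Xnorm rho T = (INF g \<in> {g. represents g T}. Xnorm rho g)"

definition multiplier_norm :: "(('a::euclidean_space \<Rightarrow> ennreal) \<Rightarrow> ennreal) \<Rightarrow> ('a \<Rightarrow> complex) \<Rightarrow> ennreal" where
  "multiplier_norm rho a = (SUP u \<in> {u. schwartz u \<and> in_X rho u \<and> \<not> (AE x in lebesgue. u x = 0)}.
       distr_Xnorm rho (mult_op_distr a u) / Xnorm rho u)"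

end

theory Submission
  imports Defs "HOL-Probability.Probability" "HOL-Computational_Algebra.Polynomial"
begin

text \<open>Modulating, translating and dilating a cutoff \<open>\<psi>\<close>, put \<open>u(x) = exp(i x \<eta>) \<psi>((x - y) / R)\<close>. Since the
  Fourier transform of \<open>u\<close> concentrates around \<open>\<eta>\<close> at scale \<open>1 / R\<close>, the function \<open>F\<^sup>-\<^sup>1 a F u\<close> differs
  from \<open>a(\<eta>) u\<close>, uniformly in \<open>x\<close> and \<open>y\<close>, by at most a kernel average of
  \<open>\<bar>a(\<eta> + \<zeta> / R) - a(\<eta>)\<bar>\<close>. Along any sequence \<open>R\<^sub>j \<rightarrow> \<infinity>\<close> this average has lower limit 0 for almost every
  \<open>\<eta>\<close>. If \<open>\<psi> = 1\<close> on the unit ball and \<open>\<psi> = 0\<close> outside the ball of radius \<open>s\<close>, comparing norms over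
  \<open>B(y, R)\<close> and \<open>B(y, s R)\<close> bounds \<open>\<bar>a(\<eta>)\<bar>\<close> by the multiplier norm times the ratio of the norms of the
  indicators of these balls. Weak doubling provides \<open>s > 1\<close>, arbitrarily large \<open>R\<close> and \<open>y\<close> for which this
  ratio is as close to 1 as desired.\<close>

section \<open>Smooth functions closed under partial derivatives\<close>

text \<open>The multiplier norm is distributional: the norm of \<open>mult_op_distr a u\<close> is
  an infimum over all functions representing it. A lower bound therefore requires every
  representative to agree almost everywhere with one explicit integral, \<open>mult_op\<close>; the
  fundamental lemma for test functions serves this purpose. Compact support of \<open>u\<close>
  allows comparison with indicators of balls, and smoothness makes its Fourier transform decay fast
  enough to absorb the weight for every real \<open>\<sigma>\<close>.

  The order of choices matters. Radii and centres supplied by weak doubling are fixed before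
  \<open>\<eta>\<close>, so that one null set serves the whole sequence; afterwards a single index
  with a small kernel average suffices for each \<open>\<eta>\<close>, which is why a lower limit is
  enough. Nothing is known about the centres, hence the need for an error estimate independent of
  \<open>y\<close>. As \<open>a\<close> is only Lebesgue measurable, a Borel version replaces it
  wherever it is composed with affine maps.\<close>

text \<open>The polynomial factor makes the family closed under differentiation.\<close>

definition flat_exp :: "real poly \<Rightarrow> real \<Rightarrow> real" where
  "flat_exp p t = (if t > 0 then poly p (1 / t) * exp (- 1 / t) else 0)"

lemma poly_times_exp_minus_tendsto_0:
  "((\<lambda>s::real. poly p s * exp (- s)) \<longlongrightarrow> 0) at_top"
proof -
  have "((\<lambda>s::real. \<Sum>i\<le>degree p. coeff p i * (s ^ i / exp s)) \<longlongrightarrow> (\<Sum>i\<le>degree p. coeff p i * 0)) at_top"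
    by (intro tendsto_intros tendsto_power_div_exp_0)
  then show ?thesis
    by (simp add: poly_altdef sum_distrib_right exp_minus divide_inverse mult.assoc)
qed

lemma flat_exp_tendsto_0: "(flat_exp p \<longlongrightarrow> 0) (at 0)"
proof -
  have "((\<lambda>t. poly p (inverse t) * exp (- inverse t)) \<longlongrightarrow> 0) (at_right 0)"
    by (rule filterlim_compose[OF poly_times_exp_minus_tendsto_0 filterlim_inverse_at_top_right])
  then have R: "(flat_exp p \<longlongrightarrow> 0) (at_right 0)"
    by (rule Lim_transform_eventually)
       (auto simp: eventually_at_right_field flat_exp_def divide_simps intro!: exI[of _ 1])
  have L: "(flat_exp p \<longlongrightarrow> 0) (at_left 0)"
    by (rule Lim_transform_eventually[OF tendsto_const])
       (auto simp: eventually_at_left_field flat_exp_def intro!: exI[of _ "-1"])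
  from L R show ?thesis by (simp add: filterlim_at_split)
qed

text \<open>With \<open>s = 1 / t\<close> the function is \<open>p(s) exp(-s)\<close> and
  \<open>ds/dt = -s^2\<close>, so the product rule leaves \<open>s^2 (p - p')(s) exp(-s)\<close>:
  the same family with a new polynomial.\<close>

lemma flat_exp_has_real_derivative:
  "(flat_exp p has_real_derivative flat_exp (monom 1 2 * (p - pderiv p)) t) (at t)"
proof -
  consider "t > 0" | "t < 0" | "t = 0" by linarith
  then show ?thesis
  proof cases
    case 1
    have "((\<lambda>t. poly p (1 / t) * exp (- 1 / t)) has_real_derivative
        flat_exp (monom 1 2 * (p - pderiv p)) t) (at t)"
      using 1
      by (auto intro!: derivative_eq_intros DERIV_chain2[OF poly_DERIV]
          simp: flat_exp_def poly_monom field_simps power2_eq_square)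
    then show ?thesis
      by (rule has_field_derivative_transform_within[of _ _ _ _ t]) (use 1 in \<open>auto simp: flat_exp_def dist_real_def\<close>)
  next
    case 2
    have "((\<lambda>t. 0) has_real_derivative flat_exp (monom 1 2 * (p - pderiv p)) t) (at t)"
      using 2 by (auto simp: flat_exp_def)
    then show ?thesis
      by (rule has_field_derivative_transform_within[of _ _ _ _ "-t"]) (use 2 in \<open>auto simp: flat_exp_def dist_real_def\<close>)
  next
    case 3
    \<comment> \<open>The difference quotient at 0 is \<open>flat_exp p h / h\<close>. Dividing by
      \<open>h\<close> multiplies the polynomial in \<open>1 / h\<close> by its variable, so the
      quotient is again in the family and tends to 0.\<close>
    have "(flat_exp (monom 1 (Suc 0) * p) \<longlongrightarrow> 0) (at 0)" by (rule flat_exp_tendsto_0)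
    moreover have "flat_exp (monom 1 (Suc 0) * p) = (\<lambda>h. flat_exp p h / h)"
      by (auto simp: flat_exp_def poly_monom)
    ultimately have "((\<lambda>h. flat_exp p h / h) \<longlongrightarrow> 0) (at 0)" by simp
    then show ?thesis using 3 by (simp add: DERIV_def flat_exp_def)
  qed
qed

text \<open>A concrete class of smooth functions, closed under partial derivatives by construction and large
  enough for all test functions needed; it avoids a general calculus of \<open>C\<^sup>\<infinity>\<close> functions.\<close>

inductive elem_smooth :: "('a::euclidean_space \<Rightarrow> complex) \<Rightarrow> bool" where
  const: "elem_smooth (\<lambda>_. c)"
| linear: "elem_smooth (\<lambda>x. complex_of_real (x \<bullet> v))"
| add: "elem_smooth f \<Longrightarrow> elem_smooth g \<Longrightarrow> elem_smooth (\<lambda>x. f x + g x)"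
| mult: "elem_smooth f \<Longrightarrow> elem_smooth g \<Longrightarrow> elem_smooth (\<lambda>x. f x * g x)"
| inverse: "elem_smooth f \<Longrightarrow> (\<And>x. f x \<noteq> 0) \<Longrightarrow> elem_smooth (\<lambda>x. inverse (f x))"
| exp: "elem_smooth f \<Longrightarrow> elem_smooth (\<lambda>x. exp (f x))"
| Re: "elem_smooth f \<Longrightarrow> elem_smooth (\<lambda>x. complex_of_real (Re (f x)))"
| flat: "elem_smooth f \<Longrightarrow> elem_smooth (\<lambda>x. complex_of_real (flat_exp p (Re (f x))))"

text \<open>The derivative is constructed inside the class, as one function \<open>g\<close> for all
  \<open>x\<close>; uniqueness of derivatives then identifies it with
  \<open>partial_deriv\<close>.\<close>

lemma elem_smooth_directional_derivative:
  assumes "elem_smooth f"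
  shows "\<exists>g. elem_smooth g \<and> (\<forall>x. ((\<lambda>t. f (x + t *\<^sub>R b)) has_vector_derivative g x) (at 0))"
  using assms
proof induction
  case (const c)
  show ?case by (rule exI[of _ "\<lambda>_. 0"]) (auto intro: elem_smooth.const)
next
  case (linear v)
  have "((\<lambda>t. complex_of_real ((x + t *\<^sub>R b) \<bullet> v)) has_vector_derivative complex_of_real (b \<bullet> v)) (at 0)" for x
    unfolding inner_add_left inner_scaleR_left of_real_add of_real_mult
    by (auto intro!: derivative_eq_intros)
  then show ?case by (intro exI[of _ "\<lambda>_. complex_of_real (b \<bullet> v)"]) (auto intro: elem_smooth.const)
next
  case (add f g)
  then obtain f' g' where "elem_smooth f'" "elem_smooth g'"
    "\<And>x. ((\<lambda>t. f (x + t *\<^sub>R b)) has_vector_derivative f' x) (at 0)"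
    "\<And>x. ((\<lambda>t. g (x + t *\<^sub>R b)) has_vector_derivative g' x) (at 0)" by metis
  then show ?case
    by (intro exI[of _ "\<lambda>x. f' x + g' x"] conjI allI elem_smooth.add has_vector_derivative_add) auto
next
  case (mult f g)
  then obtain f' g' where *: "elem_smooth f'" "elem_smooth g'"
    "\<And>x. ((\<lambda>t. f (x + t *\<^sub>R b)) has_vector_derivative f' x) (at 0)"
    "\<And>x. ((\<lambda>t. g (x + t *\<^sub>R b)) has_vector_derivative g' x) (at 0)" by metis
  have "((\<lambda>t. f (x + t *\<^sub>R b) * g (x + t *\<^sub>R b)) has_vector_derivative f x * g' x + f' x * g x) (at 0)" for x
    using has_vector_derivative_mult[OF *(3,4)[of x]] by simp
  moreover have "elem_smooth (\<lambda>x. f x * g' x + f' x * g x)"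
    using * mult by (intro elem_smooth.intros)
  ultimately show ?case by blast
next
  case (inverse f)
  then obtain f' where *: "elem_smooth f'"
    "\<And>x. ((\<lambda>t. f (x + t *\<^sub>R b)) has_vector_derivative f' x) (at 0)" by metis
  have "((\<lambda>t. inverse (f (x + t *\<^sub>R b))) has_vector_derivative (-1) * (f' x * (inverse (f x) * inverse (f x)))) (at 0)" for x
    using field_vector_diff_chain_at[OF *(2)[of x], of inverse "- (inverse (f x) * inverse (f x))"]
      DERIV_inverse'[OF DERIV_ident, of "f x" UNIV] inverse(2)[of x]
    by (simp add: o_def mult_ac)
  moreover have "elem_smooth (\<lambda>x. (-1) * (f' x * (inverse (f x) * inverse (f x))))"
    using * inverse by (intro elem_smooth.intros)
  ultimately show ?case by blast
next
  case (exp f)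
  then obtain f' where *: "elem_smooth f'"
    "\<And>x. ((\<lambda>t. f (x + t *\<^sub>R b)) has_vector_derivative f' x) (at 0)" by metis
  have "((\<lambda>t. exp (f (x + t *\<^sub>R b))) has_vector_derivative f' x * exp (f x)) (at 0)" for x
    using field_vector_diff_chain_at[OF *(2)[of x], of exp "exp (f x)"] DERIV_exp[of "f x"]
    by (simp add: o_def)
  moreover have "elem_smooth (\<lambda>x. f' x * exp (f x))"
    using * exp by (intro elem_smooth.intros)
  ultimately show ?case by blast
next
  case (Re f)
  then obtain f' where *: "elem_smooth f'"
    "\<And>x. ((\<lambda>t. f (x + t *\<^sub>R b)) has_vector_derivative f' x) (at 0)" by metis
  have "((\<lambda>t. complex_of_real (Re (f (x + t *\<^sub>R b)))) has_vector_derivative complex_of_real (Re (f' x))) (at 0)" for x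
    by (intro has_vector_derivative_of_real has_field_derivative_Re *(2))
  moreover have "elem_smooth (\<lambda>x. complex_of_real (Re (f' x)))"
    using * by (intro elem_smooth.intros)
  ultimately show ?case by blast
next
  case (flat f p)
  then obtain f' where *: "elem_smooth f'"
    "\<And>x. ((\<lambda>t. f (x + t *\<^sub>R b)) has_vector_derivative f' x) (at 0)" by metis
  let ?p = "monom 1 2 * (p - pderiv p)"
  have "((\<lambda>t. complex_of_real (flat_exp p (Re (f (x + t *\<^sub>R b))))) has_vector_derivative
      complex_of_real (flat_exp ?p (Re (f x)) * Re (f' x))) (at 0)" for x
    by (intro has_vector_derivative_of_real DERIV_chain2[OF _ has_field_derivative_Re[OF *(2)]])
       (use flat_exp_has_real_derivative[of p "Re (f x)"] in simp)
  \<comment> \<open>The chain rule brings in the factor \<open>Re (f' x)\<close>; this is the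
    purpose of the constructor \<open>Re\<close>.\<close>
  moreover have "elem_smooth (\<lambda>x. complex_of_real (flat_exp ?p (Re (f x)) * Re (f' x)))"
    unfolding of_real_mult using * flat by (intro elem_smooth.intros)
  ultimately show ?case by blast
qed

lemma elem_smooth_partial_deriv:
  assumes "elem_smooth f"
  shows "elem_smooth (partial_deriv b f)"
    and "((\<lambda>t. f (x + t *\<^sub>R b)) has_vector_derivative partial_deriv b f x) (at 0)"
proof -
  obtain g where g: "elem_smooth g" "\<And>x. ((\<lambda>t. f (x + t *\<^sub>R b)) has_vector_derivative g x) (at 0)"
    using elem_smooth_directional_derivative[OF assms] by metis
  then have "partial_deriv b f = g"
    unfolding partial_deriv_def by (intro ext vector_derivative_at) simp
  with g show "elem_smooth (partial_deriv b f)"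
    "((\<lambda>t. f (x + t *\<^sub>R b)) has_vector_derivative partial_deriv b f x) (at 0)" by simp_all
qed

lemma elem_smooth_continuous: "elem_smooth f \<Longrightarrow> continuous_on A f"
proof (induction rule: elem_smooth.induct)
  case (inverse f)
  then show ?case by (intro continuous_on_inverse) auto
next
  case (flat f p)
  have "continuous_on UNIV (flat_exp p)"
    by (intro DERIV_continuous_on[OF has_field_derivative_at_within[OF flat_exp_has_real_derivative]])
  from continuous_on_compose2[OF this continuous_on_Re[OF flat.IH]] show ?case
    by (intro continuous_on_of_real) auto
qed (intro continuous_intros; assumption)+

section \<open>Compactly supported functions of the class\<close>

definition elem_test :: "('a::euclidean_space \<Rightarrow> complex) \<Rightarrow> bool" where
  "elem_test f \<longleftrightarrow> elem_smooth f \<and> bounded {x. f x \<noteq> 0}"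

text \<open>A derivative may be nonzero at a zero of \<open>f\<close>, but only within the closure
  of the set where \<open>f\<close> is nonzero: elsewhere \<open>f\<close> vanishes on a whole
  ball.\<close>

lemma elem_test_partial_deriv:
  assumes "elem_test f"
  shows "elem_test (partial_deriv b f)"
proof -
  have f: "elem_smooth f" and bdd: "bounded {x. f x \<noteq> 0}" using assms by (auto simp: elem_test_def)
  have "partial_deriv b f x = 0" if x: "x \<notin> closure {x. f x \<noteq> 0}" for x
  proof -
    obtain e where e: "e > 0" "ball x e \<subseteq> - closure {x. f x \<noteq> 0}"
      using x open_contains_ball_eq[of "- closure {x. f x \<noteq> 0}"] by auto
    then have z: "f y = 0" if "y \<in> ball x e" for y
      using that e(2) closure_subset[of "{x. f x \<noteq> 0}"] by auto
    have "open ((\<lambda>t. x + t *\<^sub>R b) -` ball x e)"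
      by (intro open_vimage open_ball continuous_on_add continuous_on_scaleR continuous_on_id continuous_on_const)
    moreover have "0 \<in> (\<lambda>t. x + t *\<^sub>R b) -` ball x e" using e by simp
    moreover have "0 = f (x + t *\<^sub>R b)" if "t \<in> (\<lambda>t. x + t *\<^sub>R b) -` ball x e" for t
      using z[of "x + t *\<^sub>R b"] that by simp
    ultimately have "((\<lambda>t. f (x + t *\<^sub>R b)) has_vector_derivative 0) (at 0)"
      by (rule has_vector_derivative_transform_within_open[OF has_vector_derivative_const])
    then show ?thesis
      by (rule vector_derivative_unique_at[OF elem_smooth_partial_deriv(2)[OF f]])
  qed
  then have "{x. partial_deriv b f x \<noteq> 0} \<subseteq> closure {x. f x \<noteq> 0}" by blast
  then show ?thesis
    unfolding elem_test_def
    using bounded_subset[OF bounded_closure[OF bdd]] elem_smooth_partial_deriv(1)[OF f] by blast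
qed

lemma elem_test_iter_deriv: "elem_test f \<Longrightarrow> elem_test (iter_deriv bs f)"
  by (induction bs) (auto intro: elem_test_partial_deriv)

lemma elem_test_weighted_bounded:
  assumes "elem_test f"
  shows "\<exists>C. \<forall>x. norm x ^ k * cmod (f x) \<le> C"
proof -
  let ?g = "\<lambda>x. norm x ^ k * cmod (f x)" and ?K = "closure {x. f x \<noteq> 0}"
  have "compact (?g ` ?K)"
    using assms by (intro compact_continuous_image continuous_intros elem_smooth_continuous)
      (auto simp: elem_test_def)
  then have "bounded (?g ` ?K)" by (rule compact_imp_bounded)
  then obtain C where C: "\<forall>y\<in>?g ` ?K. norm y \<le> C" unfolding bounded_iff ..
  have "?g x \<le> \<bar>C\<bar>" for x
  proof (cases "f x = 0")
    case False
    then have "x \<in> ?K" using subsetD[OF closure_subset, of x "{x. f x \<noteq> 0}"] by simp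
    with C have "norm (?g x) \<le> C" by (rule bspec[OF _ imageI])
    then show ?thesis by (simp add: abs_mult)
  qed simp
  then show ?thesis by (intro exI[of _ "\<bar>C\<bar>"] allI)
qed

text \<open>All iterated derivatives are again continuous with bounded support, so every
  polynomially weighted bound is a bound on a compact set.\<close>

lemma elem_test_imp_test_function:
  assumes "elem_test f"
  shows "test_function f"
  unfolding test_function_def schwartz_def
proof (intro conjI allI impI ballI)
  fix bs :: "'a list" and k
  have *: "elem_test (iter_deriv bs f)" by (rule elem_test_iter_deriv[OF assms])
  show "\<exists>C. \<forall>x. norm x ^ k * cmod (iter_deriv bs f x) \<le> C"
    using elem_test_weighted_bounded[OF *] .
  show "(\<lambda>t. iter_deriv bs f (x + t *\<^sub>R b)) differentiable at 0" for b x
    using * unfolding elem_test_def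
    by (intro differentiableI_vector[OF elem_smooth_partial_deriv(2)]) simp
qed (use assms in \<open>auto simp: elem_test_def\<close>)

section \<open>Integration over Euclidean space\<close>

text \<open>\<open>lborel\<close> is the image of a product of one-dimensional Lebesgue measures
  under the coordinate map \<open>?s\<close>. This reduces both the Gaussian and the polynomial
  weight below to one variable.\<close>

lemma lborel_integral_prod_Basis:
  fixes f :: "'a::euclidean_space \<Rightarrow> real \<Rightarrow> complex"
  assumes "\<And>b. b \<in> Basis \<Longrightarrow> integrable lborel (f b)"
  shows "integrable lborel (\<lambda>x::'a. \<Prod>b\<in>Basis. f b (x \<bullet> b))"
    and "(\<integral>x. (\<Prod>b\<in>Basis. f b (x \<bullet> b)) \<partial>lborel) = (\<Prod>b\<in>Basis. \<integral>t. f b t \<partial>lborel)"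
proof -
  interpret product_sigma_finite "\<lambda>_::'a. lborel :: real measure" by standard
  have [measurable]: "b \<in> Basis \<Longrightarrow> f b \<in> borel_measurable borel" for b
    using borel_measurable_integrable[OF assms[of b]] by simp
  let ?s = "\<lambda>y. \<Sum>b\<in>Basis. y b *\<^sub>R (b::'a)" and ?P = "\<Pi>\<^sub>M b\<in>(Basis::'a set). (lborel::real measure)"
  let ?F = "\<lambda>x::'a. \<Prod>b\<in>Basis. f b (x \<bullet> b)"
  have s[measurable]: "?s \<in> measurable ?P borel" by measurable
  have m[measurable]: "?F \<in> borel_measurable borel" by measurable
  have eq: "?F (?s y) = (\<Prod>b\<in>Basis. f b (y b))" for y
    by (intro prod.cong refl) (simp add: inner_sum_left_Basis)
  have "integrable ?P (\<lambda>y. ?F (?s y))"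
    unfolding eq by (intro product_integrable_prod assms) auto
  then show "integrable lborel ?F"
    by (subst lborel_eq) (simp add: integrable_distr_eq)
  have "(\<integral>x. ?F x \<partial>lborel) = (\<integral>y. ?F (?s y) \<partial>?P)"
    by (subst lborel_eq) (simp add: integral_distr)
  also have "\<dots> = (\<Prod>b\<in>Basis. \<integral>t. f b t \<partial>lborel)"
    unfolding eq by (intro product_integral_prod assms) auto
  finally show "(\<integral>x. ?F x \<partial>lborel) = (\<Prod>b\<in>Basis. \<integral>t. f b t \<partial>lborel)" .
qed

section \<open>Changes of variables and exchange of integrals\<close>

lemma borel_measurable_cis [measurable]: "cis \<in> borel_measurable borel"
  by (intro borel_measurable_continuous_onI continuous_intros)

lemma lborel_integrable_shift:
  fixes f :: "'a::euclidean_space \<Rightarrow> complex"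
  assumes "integrable lborel f"
  shows "integrable lborel (\<lambda>x. f (t + x))"
proof -
  have "integrable (distr lborel borel ((+) t)) f" using assms by (simp add: lborel_distr_plus)
  then show ?thesis using borel_measurable_integrable[OF assms] by (subst (asm) integrable_distr_eq) auto
qed

lemma lborel_integral_affine:
  fixes f :: "'a::euclidean_space \<Rightarrow> complex"
  assumes [measurable]: "f \<in> borel_measurable borel" and c: "c > 0"
  shows "(\<integral>x. f x \<partial>lborel) = complex_of_real (c ^ DIM('a)) * (\<integral>x. f (t + c *\<^sub>R x) \<partial>lborel)"
  using c by (subst lborel_affine[of c t]) (auto simp: integral_density integral_distr scaleR_conv_of_real)

lemma lborel_nn_integral_affine:
  fixes f :: "'a::euclidean_space \<Rightarrow> ennreal"
  assumes [measurable]: "f \<in> borel_measurable borel" and c: "c > 0"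
  shows "(\<integral>\<^sup>+x. f x \<partial>lborel) = ennreal (c ^ DIM('a)) * (\<integral>\<^sup>+x. f (t + c *\<^sub>R x) \<partial>lborel)"
  using c by (subst lborel_affine[of c t]) (auto simp: nn_integral_density nn_integral_distr nn_integral_cmult)

text \<open>A product majorant yields integrability on the product space. Both later exchanges are
  of this kind, since a character has modulus 1 and the remaining factors separate the
  variables.\<close>

lemma lborel_Fubini_dominated:
  fixes f :: "'a::euclidean_space \<Rightarrow> 'a \<Rightarrow> complex"
  assumes f[measurable]: "(\<lambda>(x, y). f x y) \<in> borel_measurable (lborel \<Otimes>\<^sub>M lborel)"
    and p: "integrable lborel p" and q: "integrable lborel q"
    and le: "\<And>x y. cmod (f x y) \<le> p x * q y"
  shows "(\<integral>x. (\<integral>y. f x y \<partial>lborel) \<partial>lborel) = (\<integral>y. (\<integral>x. f x y \<partial>lborel) \<partial>lborel)"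
proof -
  have int2: "integrable lborel (f x)" for x
    by (rule Bochner_Integration.integrable_bound[OF integrable_mult_right[OF q, of "p x"]])
       (auto intro: order_trans[OF le abs_ge_self])
  have "integrable lborel (\<lambda>x. \<integral>y. norm (f x y) \<partial>lborel)"
  proof (rule Bochner_Integration.integrable_bound)
    show "integrable lborel (\<lambda>x. p x * (\<integral>y. q y \<partial>lborel))" using p by simp
    show "AE x in lborel. norm (\<integral>y. norm (f x y) \<partial>lborel) \<le> norm (p x * (\<integral>y. q y \<partial>lborel))"
    proof (intro AE_I2)
      fix x
      have "(\<integral>y. norm (f x y) \<partial>lborel) \<le> (\<integral>y. p x * q y \<partial>lborel)"
        by (intro integral_mono integrable_norm int2 integrable_mult_right q le)
      then show "norm (\<integral>y. norm (f x y) \<partial>lborel) \<le> norm (p x * (\<integral>y. q y \<partial>lborel))"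
        by simp
    qed
  qed measurable
  then have "integrable (lborel \<Otimes>\<^sub>M lborel) (\<lambda>(x, y). f x y)"
    by (intro lborel_pair.Fubini_integrable) (use int2 in auto)
  from lborel_pair.Fubini_integral[OF this] show ?thesis by simp
qed

text \<open>The exponent comes from comparison with the product over coordinates of
  \<open>1 / (1 + t^2)\<close>: each coordinate costs one factor
  \<open>(1 + norm x)\<^sup>2\<close>.\<close>

lemma integrable_inverse_one_plus_norm_power:
  "integrable lborel (\<lambda>x::'a::euclidean_space. inverse ((1 + norm x) ^ (2 * DIM('a))))"
proof (rule Bochner_Integration.integrable_bound)
  have "integrable lborel (\<lambda>t::real. inverse (1 + t\<^sup>2))"
    using integrable_inverse_1_plus_square by (simp add: set_integrable_def einterval_def)
  then have "integrable lborel (\<lambda>t. complex_of_real (inverse (1 + t\<^sup>2)))" by (rule integrable_of_real)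
  from lborel_integral_prod_Basis(1)[of "\<lambda>b::'a. \<lambda>t. complex_of_real (inverse (1 + t\<^sup>2))", OF this]
  show "integrable lborel (\<lambda>x::'a. \<Prod>b\<in>Basis. complex_of_real (inverse (1 + (x \<bullet> b)\<^sup>2)))" .
  show "AE x::'a in lborel. norm (inverse ((1 + norm x) ^ (2 * DIM('a)))) \<le>
      norm (\<Prod>b\<in>Basis. complex_of_real (inverse (1 + (x \<bullet> b)\<^sup>2)))"
  proof (intro AE_I2)
    fix x :: 'a
    have "1 + (x \<bullet> b)\<^sup>2 \<le> (1 + norm x)\<^sup>2" if "b \<in> Basis" for b
    proof -
      have "\<bar>x \<bullet> b\<bar>\<^sup>2 \<le> (norm x)\<^sup>2" using that by (intro power_mono Basis_le_norm) auto
      then show ?thesis using norm_ge_zero[of x] by (simp add: power2_sum del: norm_ge_zero)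
    qed
    then have "(\<Prod>b\<in>(Basis::'a set). inverse ((1 + norm x)\<^sup>2)) \<le> (\<Prod>b\<in>Basis. inverse (1 + (x \<bullet> b)\<^sup>2))"
      by (intro prod_mono) (auto intro!: le_imp_inverse_le simp: add_pos_nonneg)
    moreover have "(\<Prod>b\<in>(Basis::'a set). inverse ((1 + norm x)\<^sup>2)) = inverse ((1 + norm x) ^ (2 * DIM('a)))"
      by (simp add: power_mult power_inverse)
    moreover have "norm (\<Prod>b\<in>Basis. complex_of_real (inverse (1 + (x \<bullet> b)\<^sup>2))) = (\<Prod>b\<in>Basis. inverse (1 + (x \<bullet> b)\<^sup>2))"
      unfolding of_real_prod[symmetric] norm_of_real by (simp add: abs_prod abs_of_pos add_pos_nonneg prod_nonneg)
    ultimately show "norm (inverse ((1 + norm x) ^ (2 * DIM('a)))) \<le>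
      norm (\<Prod>b\<in>Basis. complex_of_real (inverse (1 + (x \<bullet> b)\<^sup>2)))" by simp
  qed
qed measurable

text \<open>Up to the factor \<open>sqrt (2 * pi)\<close>, this is the characteristic function of
  the standard normal distribution.\<close>

lemma gaussian_real_fourier:
  shows "integrable lborel (\<lambda>t::real. cis (v * t) * exp (- t\<^sup>2 / 2))"
    and "(\<integral>t. cis (v * t) * exp (- t\<^sup>2 / 2) \<partial>lborel) = complex_of_real (sqrt (2 * pi) * exp (- v\<^sup>2 / 2))"
proof -
  have eq: "cis (v * t) * exp (- t\<^sup>2 / 2) =
      complex_of_real (sqrt (2 * pi)) * (std_normal_density t *\<^sub>R iexp (v * t))" for t
    by (simp add: std_normal_density_def cis_conv_exp scaleR_conv_of_real field_simps
        del: of_real_mult flip: of_real_mult)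
  have "integrable std_normal_distribution (\<lambda>t. iexp (v * t))"
    by (intro finite_measure.integrable_const_bound[where B=1] prob_space.finite_measure prob_space_normal_density) auto
  then have int: "integrable lborel (\<lambda>t. std_normal_density t *\<^sub>R iexp (v * t))"
    by (subst (asm) integrable_density) auto
  then show "integrable lborel (\<lambda>t::real. cis (v * t) * exp (- t\<^sup>2 / 2))"
    unfolding eq by (rule integrable_mult_right)
  have "(\<integral>t. std_normal_density t *\<^sub>R iexp (v * t) \<partial>lborel) = char std_normal_distribution v"
    unfolding char_def by (subst integral_density) auto
  then show "(\<integral>t. cis (v * t) * exp (- t\<^sup>2 / 2) \<partial>lborel) = complex_of_real (sqrt (2 * pi) * exp (- v\<^sup>2 / 2))"
    unfolding eq integral_mult_right_zero by (simp add: char_std_normal_distribution)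
qed

lemma gaussian_fourier:
  fixes v :: "'a::euclidean_space"
  shows "integrable lborel (\<lambda>x. cis (v \<bullet> x) * exp (- (norm x)\<^sup>2 / 2))"
    and "(\<integral>x. cis (v \<bullet> x) * exp (- (norm x)\<^sup>2 / 2) \<partial>lborel) =
      complex_of_real (sqrt (2 * pi) ^ DIM('a) * exp (- (norm v)\<^sup>2 / 2))"
proof -
  have nrm: "- (norm x)\<^sup>2 / 2 = (\<Sum>b\<in>Basis. - (x \<bullet> b)\<^sup>2 / 2)" for x :: 'a
    unfolding power2_norm_eq_inner euclidean_inner[of x x]
    by (simp add: power2_eq_square sum_negf sum_divide_distrib)
  have eq: "cis (v \<bullet> x) * exp (- (norm x)\<^sup>2 / 2) =
      (\<Prod>b\<in>Basis. cis ((v \<bullet> b) * (x \<bullet> b)) * exp (- (x \<bullet> b)\<^sup>2 / 2))" for x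
  proof -
    have "cis (v \<bullet> x) = (\<Prod>b\<in>Basis. cis ((v \<bullet> b) * (x \<bullet> b)))"
      unfolding cis_conv_exp by (subst exp_sum[symmetric]) (auto simp: euclidean_inner[of v x] sum_distrib_left)
    moreover have "exp (- (norm x)\<^sup>2 / 2) = (\<Prod>b\<in>Basis. exp (- (x \<bullet> b)\<^sup>2 / 2))"
      unfolding nrm by (rule exp_sum) simp
    ultimately show ?thesis by (simp add: prod.distrib)
  qed
  note * = lborel_integral_prod_Basis[of "\<lambda>b t. cis ((v \<bullet> b) * t) * exp (- t\<^sup>2 / 2)", OF gaussian_real_fourier(1)]
  show "integrable lborel (\<lambda>x. cis (v \<bullet> x) * exp (- (norm x)\<^sup>2 / 2))"
    unfolding eq by (rule *(1))
  have "(\<Prod>b\<in>Basis. sqrt (2 * pi) * exp (- (v \<bullet> b)\<^sup>2 / 2)) = sqrt (2 * pi) ^ DIM('a) * exp (- (norm v)\<^sup>2 / 2)"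
    unfolding nrm by (simp add: prod.distrib exp_sum)
  then show "(\<integral>x. cis (v \<bullet> x) * exp (- (norm x)\<^sup>2 / 2) \<partial>lborel) =
      complex_of_real (sqrt (2 * pi) ^ DIM('a) * exp (- (norm v)\<^sup>2 / 2))"
    unfolding eq *(2) gaussian_real_fourier(2) of_real_prod[symmetric] by (rule arg_cong)
qed

section \<open>Fourier transform of test functions\<close>

lemma elem_smooth_measurable [measurable_dest]: "elem_smooth f \<Longrightarrow> f \<in> borel_measurable borel"
  by (intro borel_measurable_continuous_onI elem_smooth_continuous)

lemma elem_test_measurable [measurable_dest]: "elem_test f \<Longrightarrow> f \<in> borel_measurable borel"
  by (simp add: elem_test_def elem_smooth_measurable)

lemma elem_test_bounded_support:
  assumes "elem_test f"
  obtains r where "r > 0" "\<And>x. f x \<noteq> 0 \<Longrightarrow> norm x \<le> r"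
  using assms unfolding elem_test_def bounded_pos by auto

lemma elem_test_bounded:
  assumes "elem_test f"
  obtains B where "\<And>x. cmod (f x) \<le> B"
  using elem_test_weighted_bounded[OF assms, of 0] by auto

lemma elem_test_integrable:
  fixes f :: "'a::euclidean_space \<Rightarrow> complex"
  assumes "elem_test f"
  shows "integrable lborel f"
proof -
  obtain r where r: "\<And>x. f x \<noteq> 0 \<Longrightarrow> norm x \<le> r" using elem_test_bounded_support[OF assms] by metis
  obtain B where B: "\<And>x. cmod (f x) \<le> B" using elem_test_bounded[OF assms] by metis
  show ?thesis
  proof (rule Bochner_Integration.integrable_bound)
    show "integrable lborel (\<lambda>x. B * indicator (cball 0 r) x :: real)"
      by (intro integrable_mult_right integrable_real_indicator) (auto simp: emeasure_lborel_cball_finite[unfolded infinity_ennreal_def])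
    show "AE x in lborel. cmod (f x) \<le> norm (B * indicator (cball 0 r) x :: real)"
      using B r by (intro AE_I2) (fastforce simp: indicator_def intro: order_trans[OF _ abs_ge_self])
    show "f \<in> borel_measurable lborel" using elem_test_measurable[OF assms] by simp
  qed
qed

lemma has_vector_derivative_at_0_iff:
  "(f has_vector_derivative D) (at 0) \<longleftrightarrow> ((\<lambda>h. (f h - f 0) /\<^sub>R h) \<longlongrightarrow> D) (at (0::real))"
proof -
  have "norm ((f h - f 0) /\<^sub>R h - D) = norm (f h - f 0 - h *\<^sub>R D) / norm h" if "h \<noteq> 0" for h
  proof -
    have "(f h - f 0) /\<^sub>R h - D = (f h - f 0 - h *\<^sub>R D) /\<^sub>R h"
      using that by (simp add: scaleR_diff_right)
    then show ?thesis by (simp add: divide_inverse_commute)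
  qed
  then have "((\<lambda>h. norm ((f h - f 0) /\<^sub>R h - D)) \<longlongrightarrow> 0) (at 0) \<longleftrightarrow>
      ((\<lambda>h. norm (f h - f 0 - h *\<^sub>R D) / norm h) \<longlongrightarrow> 0) (at 0)"
    by (intro filterlim_cong refl) (auto simp: eventually_at_filter)
  then show ?thesis
    unfolding has_vector_derivative_def has_derivative_at
    by (simp add: bounded_linear_scaleR_left tendsto_norm_zero_iff Lim_null[symmetric]
        flip: Lim_null)
qed

text \<open>By translation invariance the difference quotients of \<open>F\<close> have integral 0.\<close>

lemma integral_partial_deriv_eq_0:
  fixes F :: "'a::euclidean_space \<Rightarrow> complex"
  assumes F: "elem_test F"
  shows "(\<integral>x. partial_deriv b F x \<partial>lborel) = 0"
proof -
  have sm: "elem_smooth F" using F by (simp add: elem_test_def)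
  note [measurable] = elem_test_measurable[OF F] elem_test_measurable[OF elem_test_partial_deriv[OF F]]
  obtain r where r: "\<And>x. F x \<noteq> 0 \<Longrightarrow> norm x \<le> r" using elem_test_bounded_support[OF F] by metis
  obtain B where B: "\<And>x. cmod (partial_deriv b F x) \<le> B"
    using elem_test_bounded[OF elem_test_partial_deriv[OF F]] by metis
  define t where "t k = inverse (real (Suc k))" for k
  have t: "t k > 0" "t k \<le> 1" for k by (auto simp: t_def divide_simps)
  define q where "q k x = (F (x + t k *\<^sub>R b) - F x) /\<^sub>R t k" for k x
  have deriv: "((\<lambda>s. F (x + s *\<^sub>R b)) has_vector_derivative partial_deriv b F (x + s *\<^sub>R b)) (at s)" for x s
  proof -
    have "((\<lambda>s'. F (x + s *\<^sub>R b + s' *\<^sub>R b)) \<circ> (\<lambda>u. u - s) has_vector_derivative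
        1 *\<^sub>R partial_deriv b F (x + s *\<^sub>R b)) (at s)"
      by (rule vector_diff_chain_at)
         (auto intro!: derivative_eq_intros elem_smooth_partial_deriv(2)[OF sm])
    then show ?thesis by (simp add: o_def algebra_simps)
  qed
  \<comment> \<open>This bounds the difference quotients uniformly in \<open>k\<close>, as dominated
    convergence requires.\<close>
  have mvt: "cmod (F (x + s *\<^sub>R b) - F x) \<le> B * s" if "s > 0" for x s
  proof -
    have "norm (F (x + s *\<^sub>R b) - F (x + 0 *\<^sub>R b)) \<le> B * s - B * 0"
    proof (rule differentiable_bound_general[where \<phi>'="\<lambda>_. B" and f'="\<lambda>u. partial_deriv b F (x + u *\<^sub>R b)"])
      show "continuous_on {0..s} (\<lambda>s. F (x + s *\<^sub>R b))"
        by (intro continuous_at_imp_continuous_on ballI has_vector_derivative_continuous[OF deriv])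
    qed (auto intro!: that deriv B continuous_intros derivative_eq_intros)
    then show ?thesis by simp
  qed
  have q0: "(\<integral>x. q k x \<partial>lborel) = 0" for k
  proof -
    have "integrable lborel F" by (rule elem_test_integrable[OF F])
    moreover have shift: "integrable lborel (\<lambda>x. F (x + t k *\<^sub>R b))"
      "(\<integral>x. F (x + t k *\<^sub>R b) \<partial>lborel) = (\<integral>x. F x \<partial>lborel)"
      using lborel_integrable_shift[OF elem_test_integrable[OF F], of "t k *\<^sub>R b"]
        lborel_integral_affine[of F 1 "t k *\<^sub>R b"] by (simp_all add: add.commute)
    ultimately show ?thesis unfolding q_def by simp
  qed
  have "(\<lambda>k. \<integral>x. q k x \<partial>lborel) \<longlonglongrightarrow> (\<integral>x. partial_deriv b F x \<partial>lborel)"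
  proof (rule integral_dominated_convergence)
    \<comment> \<open>Since \<open>t k \<le> 1\<close>, a point where \<open>F x\<close> or its
      translate is nonzero lies within \<open>r + norm b\<close> of the origin, so one ball carries
      all quotients.\<close>
    show "integrable lborel (\<lambda>x. B * indicator (cball 0 (r + norm b)) x :: real)"
      by (intro integrable_mult_right integrable_real_indicator) (auto simp: emeasure_lborel_cball_finite[unfolded infinity_ennreal_def])
    show "AE x in lborel. norm (q k x) \<le> B * indicator (cball 0 (r + norm b)) x" for k
    proof (intro AE_I2)
      fix x
      show "norm (q k x) \<le> B * indicator (cball 0 (r + norm b)) x"
      proof (cases "norm x \<le> r + norm b")
        case True
        then show ?thesis using mvt[OF t(1), of x k] t[of k]
            by (simp add: q_def norm_divide divide_inverse_commute[symmetric] pos_divide_le_eq)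
      next
        case False
        have "norm x \<le> norm (x + t k *\<^sub>R b) + norm (t k *\<^sub>R b)"
          using norm_triangle_ineq4[of "x + t k *\<^sub>R b" "t k *\<^sub>R b"] by simp
        moreover have "norm (t k *\<^sub>R b) \<le> norm b" using t[of k] by (simp add: mult_left_le_one_le)
        ultimately have "F (x + t k *\<^sub>R b) = 0" "F x = 0" using False r[of x] r[of "x + t k *\<^sub>R b"]
          norm_ge_zero[of b] by fastforce+
        then show ?thesis using False by (simp add: q_def)
      qed
    qed
    show "AE x in lborel. (\<lambda>k. q k x) \<longlonglongrightarrow> partial_deriv b F x"
    proof (intro AE_I2)
      fix x
      have "((\<lambda>h. (F (x + h *\<^sub>R b) - F x) /\<^sub>R h) \<longlongrightarrow> partial_deriv b F x) (at 0)"
        using elem_smooth_partial_deriv(2)[OF sm, of x b] unfolding has_vector_derivative_at_0_iff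
        by simp
      moreover have "filterlim t (at 0) sequentially"
        unfolding filterlim_at t_def using LIMSEQ_inverse_real_of_nat by auto
      ultimately show "(\<lambda>k. q k x) \<longlonglongrightarrow> partial_deriv b F x"
        unfolding q_def by (rule filterlim_compose)
    qed
    show "q k \<in> borel_measurable lborel" for k unfolding q_def by measurable
  qed simp
  then show ?thesis unfolding q0 using LIMSEQ_unique tendsto_const by blast
qed

lemma elem_smooth_cis: "elem_smooth (\<lambda>x. cis (x \<bullet> v))"
  unfolding cis_conv_exp by (intro elem_smooth.intros)

lemma fourier_lborel:
  assumes "elem_test f"
  shows "fourier f \<xi> = (\<integral>x. f x * cis (- (x \<bullet> \<xi>)) \<partial>lborel)"
proof -
  note [measurable] = elem_test_measurable[OF assms]
  have "(\<lambda>x. f x * cis (- (x \<bullet> \<xi>))) \<in> borel_measurable borel" by measurable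
  then show ?thesis unfolding fourier_def by (intro integral_completion) simp
qed

lemma elem_test_mult_smooth:
  assumes "elem_test f" "elem_smooth g"
  shows "elem_test (\<lambda>x. f x * g x)"
  using assms bounded_subset[of "{x. f x \<noteq> 0}" "{x. f x * g x \<noteq> 0}"]
  by (auto simp: elem_test_def intro: elem_smooth.mult)

text \<open>Integration by parts without boundary terms: the derivative of \<open>f\<close> times a
  character has integral 0, and differentiating the character produces the factor
  \<open>\<xi> \<bullet> b\<close>.\<close>

lemma fourier_partial_deriv:
  fixes f :: "'a::euclidean_space \<Rightarrow> complex"
  assumes f: "elem_test f"
  shows "fourier (partial_deriv b f) \<xi> = \<i> * complex_of_real (\<xi> \<bullet> b) * fourier f \<xi>"
proof -
  have sm: "elem_smooth f" using f by (simp add: elem_test_def)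
  define e where "e x = cis (x \<bullet> - \<xi>)" for x :: 'a
  have e: "elem_smooth e" unfolding e_def by (rule elem_smooth_cis)
  have "((\<lambda>t. e (x + t *\<^sub>R b)) has_vector_derivative - \<i> * complex_of_real (\<xi> \<bullet> b) * e x) (at 0)" for x
    unfolding e_def cis_conv_exp inner_add_left inner_scaleR_left
    by (auto intro!: derivative_eq_intros has_vector_derivative_real_field simp: inner_commute)
  from has_vector_derivative_mult[OF elem_smooth_partial_deriv(2)[OF sm, of _ b] this]
  have "((\<lambda>t. f (x + t *\<^sub>R b) * e (x + t *\<^sub>R b)) has_vector_derivative
      partial_deriv b f x * e x - \<i> * complex_of_real (\<xi> \<bullet> b) * (f x * e x)) (at 0)" for x
    by (simp add: algebra_simps)
  then have "partial_deriv b (\<lambda>x. f x * e x) =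
      (\<lambda>x. partial_deriv b f x * e x - \<i> * complex_of_real (\<xi> \<bullet> b) * (f x * e x))"
    unfolding partial_deriv_def[of b "\<lambda>x. f x * e x"] by (intro ext vector_derivative_at) simp
  with integral_partial_deriv_eq_0[OF elem_test_mult_smooth[OF f e], of b]
  have "(\<integral>x. partial_deriv b f x * e x - \<i> * complex_of_real (\<xi> \<bullet> b) * (f x * e x) \<partial>lborel) = 0" by simp
  moreover have "integrable lborel (\<lambda>x. partial_deriv b f x * e x)" "integrable lborel (\<lambda>x. f x * e x)"
    by (intro elem_test_integrable elem_test_mult_smooth elem_test_partial_deriv f e)+
  ultimately show ?thesis
    unfolding fourier_lborel[OF f] fourier_lborel[OF elem_test_partial_deriv[OF f]]
    by (simp add: e_def)
qed

text \<open>One more power of the weight costs one derivative: \<open>norm \<xi>\<close> is at most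
  the sum of the \<open>\<bar>\<xi> \<bullet> b\<bar>\<close>, and each of these factors turns
  \<open>f\<close> into a partial derivative, to which the induction hypothesis applies because
  \<open>f\<close> is arbitrary.\<close>

lemma fourier_decay:
  fixes f :: "'a::euclidean_space \<Rightarrow> complex"
  assumes "elem_test f"
  shows "\<exists>C. \<forall>\<xi>. (1 + norm \<xi>) ^ N * cmod (fourier f \<xi>) \<le> C"
  using assms
proof (induction N arbitrary: f)
  case 0
  have "cmod (fourier f \<xi>) \<le> (\<integral>x. cmod (f x) \<partial>lborel)" for \<xi>
    unfolding fourier_lborel[OF 0] using integral_norm_bound[of lborel "\<lambda>x. f x * cis (- (x \<bullet> \<xi>))"]
    by (simp add: norm_mult)
  then show ?case by auto
next
  case (Suc N)
  obtain C where C: "\<And>\<xi>. (1 + norm \<xi>) ^ N * cmod (fourier f \<xi>) \<le> C" using Suc by blast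
  obtain D where D: "\<And>b \<xi>. (1 + norm \<xi>) ^ N * cmod (fourier (partial_deriv b f) \<xi>) \<le> D b"
    using Suc.IH[OF elem_test_partial_deriv[OF Suc.prems]] by metis
  have "(1 + norm \<xi>) ^ Suc N * cmod (fourier f \<xi>) \<le> C + (\<Sum>b\<in>Basis. D b)" for \<xi>
  proof -
    let ?w = "(1 + norm \<xi>) ^ N * cmod (fourier f \<xi>)"
    have "?w * norm \<xi> \<le> ?w * (\<Sum>b\<in>Basis. \<bar>\<xi> \<bullet> b\<bar>)"
      by (intro mult_left_mono norm_le_l1) auto
    also have "\<dots> = (\<Sum>b\<in>Basis. (1 + norm \<xi>) ^ N * cmod (fourier (partial_deriv b f) \<xi>))"
      by (simp add: fourier_partial_deriv[OF Suc.prems] norm_mult sum_distrib_left mult_ac)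
    also have "\<dots> \<le> (\<Sum>b\<in>Basis. D b)" by (intro sum_mono D)
    finally show ?thesis using C[of \<xi>] by (simp add: algebra_simps)
  qed
  then show ?case by blast
qed

lemma fourier_measurable:
  assumes "elem_test f"
  shows "fourier f \<in> borel_measurable borel"
proof -
  note [measurable] = elem_test_measurable[OF assms]
  have "(\<lambda>\<xi>. \<integral>x. f x * cis (- (x \<bullet> \<xi>)) \<partial>lborel) \<in> borel_measurable borel"
    by measurable
  then show ?thesis using fourier_lborel[OF assms] by (simp cong: measurable_cong)
qed

lemma fourier_integrable:
  fixes f :: "'a::euclidean_space \<Rightarrow> complex"
  assumes "elem_test f"
  shows "integrable lborel (\<lambda>\<xi>. (1 + norm \<xi>) ^ N * cmod (fourier f \<xi>))"
proof -
  note [measurable] = fourier_measurable[OF assms]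
  \<comment> \<open>The surplus \<open>2 * DIM('a)\<close> powers leave the integrable weight as
    majorant.\<close>
  obtain C where C: "\<And>\<xi>. (1 + norm \<xi>) ^ (N + 2 * DIM('a)) * cmod (fourier f \<xi>) \<le> C"
    using fourier_decay[OF assms] by blast
  show ?thesis
  proof (rule Bochner_Integration.integrable_bound)
    show "integrable lborel (\<lambda>\<xi>::'a. C * inverse ((1 + norm \<xi>) ^ (2 * DIM('a))))"
      by (intro integrable_mult_right integrable_inverse_one_plus_norm_power)
    show "AE \<xi> in lborel. norm ((1 + norm \<xi>) ^ N * cmod (fourier f \<xi>)) \<le>
        norm (C * inverse ((1 + norm \<xi>) ^ (2 * DIM('a))))"
    proof (intro AE_I2)
      fix \<xi> :: 'a
      have "(1 + norm \<xi>) ^ N * cmod (fourier f \<xi>) \<le> C * inverse ((1 + norm \<xi>) ^ (2 * DIM('a)))"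
        using C[of \<xi>] norm_ge_zero[of \<xi>] by (simp add: power_add field_simps add_pos_nonneg)
      then show "norm ((1 + norm \<xi>) ^ N * cmod (fourier f \<xi>)) \<le> norm (C * inverse ((1 + norm \<xi>) ^ (2 * DIM('a))))"
        using mult_right_mono[OF abs_ge_self[of C], of "inverse ((1 + norm \<xi>) ^ (2 * DIM('a)))"]
        by (simp add: abs_mult)
    qed
  qed measurable
qed

text \<open>Gaussian regularisation: insert \<open>exp(-\<bar>\<epsilon> \<xi>\<bar>\<^sup>2 / 2)\<close>, swap the integrals and let \<open>\<epsilon> \<rightarrow> 0\<close>.\<close>

lemma fourier_inversion:
  fixes f :: "'a::euclidean_space \<Rightarrow> complex"
  assumes f: "elem_test f"
  shows "(\<integral>\<xi>. fourier f \<xi> * cis (x \<bullet> \<xi>) \<partial>lborel) = complex_of_real ((2 * pi) ^ DIM('a)) * f x"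
proof -
  note [measurable] = elem_test_measurable[OF f] fourier_measurable[OF f]
  let ?G = "\<lambda>x::'a. exp (- (norm x)\<^sup>2 / 2)" and ?c = "sqrt (2 * pi) ^ DIM('a)"
  have intG: "integrable lborel ?G"
    using integrable_Re[OF gaussian_fourier(1)[of 0]] by simp
  have "complex_of_real (\<integral>z. ?G z \<partial>lborel) = complex_of_real ?c"
    using gaussian_fourier(2)[of "0::'a"] by simp
  then have c2: "(\<integral>z. ?G z \<partial>lborel) = ?c" by (simp only: of_real_eq_iff)
  obtain B where B: "\<And>x. cmod (f x) \<le> B" using elem_test_bounded[OF f] by metis
  define e where "e k = inverse (real (Suc k))" for k
  have e: "e k > 0" for k by (auto simp: e_def)
  have e0: "e \<longlonglongrightarrow> 0" unfolding e_def by (rule LIMSEQ_inverse_real_of_nat)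
  define I where "I k = (\<integral>\<xi>. fourier f \<xi> * cis (x \<bullet> \<xi>) * ?G (e k *\<^sub>R \<xi>) \<partial>lborel)" for k
  have limI: "I \<longlonglongrightarrow> (\<integral>\<xi>. fourier f \<xi> * cis (x \<bullet> \<xi>) \<partial>lborel)"
    unfolding I_def
  proof (rule integral_dominated_convergence)
    show "integrable lborel (\<lambda>\<xi>. cmod (fourier f \<xi>))" using fourier_integrable[OF f, of 0] by simp
    show "AE \<xi> in lborel. norm (fourier f \<xi> * cis (x \<bullet> \<xi>) * ?G (e k *\<^sub>R \<xi>)) \<le> cmod (fourier f \<xi>)" for k
      by (intro AE_I2) (simp add: norm_mult mult_left_le)
    show "AE \<xi> in lborel. (\<lambda>k. fourier f \<xi> * cis (x \<bullet> \<xi>) * ?G (e k *\<^sub>R \<xi>)) \<longlonglongrightarrow> fourier f \<xi> * cis (x \<bullet> \<xi>)"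
      by (intro AE_I2) (auto intro!: tendsto_eq_intros e0)
  qed measurable
  have I_eq: "I k = ?c * (\<integral>z. f (x + e k *\<^sub>R z) * ?G z \<partial>lborel)" for k
  proof -
    \<comment> \<open>A narrow factor \<open>e k\<close> in frequency becomes a Gaussian of width
      \<open>e k\<close> centred at \<open>x\<close>, by the substitution
      \<open>\<zeta> = e k *\<^sub>R \<xi>\<close>.\<close>
    have inner: "(\<integral>\<xi>. cis ((x - y) \<bullet> \<xi>) * ?G (e k *\<^sub>R \<xi>) \<partial>lborel) =
        complex_of_real (?c * (1 / e k) ^ DIM('a) * ?G ((1 / e k) *\<^sub>R (x - y)))" for y
    proof -
      have "(\<integral>\<xi>. cis ((x - y) \<bullet> \<xi>) * ?G (e k *\<^sub>R \<xi>) \<partial>lborel) = complex_of_real ((1 / e k) ^ DIM('a)) *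
          (\<integral>\<zeta>. cis (((1 / e k) *\<^sub>R (x - y)) \<bullet> \<zeta>) * ?G \<zeta> \<partial>lborel)"
        using e[of k] by (subst lborel_integral_affine[where t=0 and c="1 / e k"]) auto
      then show ?thesis unfolding gaussian_fourier(2) by simp
    qed
    have intGe: "integrable lborel (\<lambda>\<xi>::'a. ?G (e k *\<^sub>R \<xi>))"
    proof -
      have "integrable lborel (\<lambda>\<xi>::'a. ?G \<xi>)" by (rule intG)
      then have "integrable (density (distr lborel borel (\<lambda>x. 0 + e k *\<^sub>R x)) (\<lambda>_. \<bar>e k\<bar>^DIM('a))) ?G"
        using lborel_affine[of "e k" "0::'a"] e[of k] by simp
      then show ?thesis
        using e[of k] by (simp add: integrable_density integrable_distr_eq)
    qed
    have "I k = (\<integral>\<xi>. (\<integral>y. f y * cis ((x - y) \<bullet> \<xi>) * ?G (e k *\<^sub>R \<xi>) \<partial>lborel) \<partial>lborel)"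
      unfolding I_def
    proof (intro Bochner_Integration.integral_cong refl)
      fix \<xi>
      have cis_diff: "cis ((x - y) \<bullet> \<xi>) = cis (- (y \<bullet> \<xi>)) * cis (x \<bullet> \<xi>)" for y
        by (simp add: cis_mult inner_diff_left)
      have "fourier f \<xi> * cis (x \<bullet> \<xi>) * ?G (e k *\<^sub>R \<xi>) =
          (\<integral>y. f y * cis (- (y \<bullet> \<xi>)) * (cis (x \<bullet> \<xi>) * ?G (e k *\<^sub>R \<xi>)) \<partial>lborel)"
        unfolding integral_mult_left_zero fourier_lborel[OF f] by simp
      also have "\<dots> = (\<integral>y. f y * cis ((x - y) \<bullet> \<xi>) * ?G (e k *\<^sub>R \<xi>) \<partial>lborel)"
        by (intro Bochner_Integration.integral_cong refl) (simp only: cis_diff mult_ac)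
      finally show "fourier f \<xi> * cis (x \<bullet> \<xi>) * ?G (e k *\<^sub>R \<xi>) =
          (\<integral>y. f y * cis ((x - y) \<bullet> \<xi>) * ?G (e k *\<^sub>R \<xi>) \<partial>lborel)" .
    qed
    also have "\<dots> = (\<integral>y. (\<integral>\<xi>. f y * cis ((x - y) \<bullet> \<xi>) * ?G (e k *\<^sub>R \<xi>) \<partial>lborel) \<partial>lborel)"
      by (rule lborel_Fubini_dominated[OF _ intGe integrable_norm[OF elem_test_integrable[OF f]]])
         (measurable, simp add: norm_mult)
    also have "\<dots> = (\<integral>y. f y * complex_of_real (?c * (1 / e k) ^ DIM('a) * ?G ((1 / e k) *\<^sub>R (x - y))) \<partial>lborel)"
      by (simp only: mult.assoc integral_mult_right_zero inner)
    \<comment> \<open>Substituting \<open>y = x + e k *\<^sub>R z\<close> fixes the Gaussian and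
      moves the dependence on \<open>k\<close> into \<open>f\<close>; the Jacobian cancels
      \<open>(1 / e k) ^ DIM('a)\<close>.\<close>
    also have "\<dots> = complex_of_real (e k ^ DIM('a)) *
        (\<integral>z. f (x + e k *\<^sub>R z) * complex_of_real (?c * (1 / e k) ^ DIM('a) * ?G ((1 / e k) *\<^sub>R (x - (x + e k *\<^sub>R z)))) \<partial>lborel)"
      by (rule lborel_integral_affine[OF _ e]) measurable
    also have "\<dots> = complex_of_real (e k ^ DIM('a)) *
        (\<integral>z. complex_of_real (?c * (1 / e k) ^ DIM('a)) * (f (x + e k *\<^sub>R z) * complex_of_real (?G z)) \<partial>lborel)"
      using e[of k] by (simp add: mult_ac)
    also have "\<dots> = ?c * (\<integral>z. f (x + e k *\<^sub>R z) * ?G z \<partial>lborel)"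
      unfolding integral_mult_right_zero using e[of k] by (simp add: power_divide)
    finally show ?thesis .
  qed
  have "(\<lambda>k. ?c * (\<integral>z. f (x + e k *\<^sub>R z) * ?G z \<partial>lborel)) \<longlonglongrightarrow> ?c * (\<integral>z. f x * ?G z \<partial>lborel)"
  proof (intro tendsto_mult tendsto_const integral_dominated_convergence)
    show "integrable lborel (\<lambda>z. B * ?G z)" by (intro integrable_mult_right intG)
    show "AE z in lborel. norm (f (x + e k *\<^sub>R z) * ?G z) \<le> B * ?G z" for k
      by (intro AE_I2) (simp add: norm_mult B)
    have "isCont f x" using f elem_smooth_continuous[of f UNIV] by (simp add: elem_test_def continuous_on_eq_continuous_at)
    then show "AE z in lborel. (\<lambda>k. f (x + e k *\<^sub>R z) * ?G z) \<longlonglongrightarrow> f x * ?G z"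
      by (intro AE_I2 tendsto_mult tendsto_const isCont_tendsto_compose[of x f]) (auto intro!: tendsto_eq_intros e0)
  qed measurable
  then have "I \<longlonglongrightarrow> ?c * (\<integral>z. f x * ?G z \<partial>lborel)"
    by (rule Lim_transform_eventually) (intro always_eventually allI I_eq[symmetric])
  with limI have "(\<integral>\<xi>. fourier f \<xi> * cis (x \<bullet> \<xi>) \<partial>lborel) = ?c * (\<integral>z. f x * ?G z \<partial>lborel)"
    by (rule LIMSEQ_unique)
  \<comment> \<open>One \<open>?c\<close> comes from the Fourier transform of the Gaussian, the
    other from its total integral.\<close>
  also have "\<dots> = complex_of_real (?c * ?c) * f x"
    unfolding integral_mult_right_zero using c2 by simp
  also have "?c * ?c = (2 * pi) ^ DIM('a)" by (subst power_mult_distrib[symmetric]) simp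
  finally show ?thesis .
qed

section \<open>Translations in \<open>L\<^sup>1\<close> and kernel averages\<close>

text \<open>The three-epsilon argument: translation invariance makes the error of replacing
  \<open>f\<close> by \<open>g\<close> the same before and after the shift. It is isolated because
  two cases of the induction over integrable functions end with it.\<close>

lemma L1_translation_approx:
  fixes f :: "'a::euclidean_space \<Rightarrow> complex"
  assumes f: "integrable lborel f"
    and approx: "\<And>e::real. e > 0 \<Longrightarrow> \<exists>g. integrable lborel g \<and> (\<integral>x. cmod (f x - g x) \<partial>lborel) < e \<and>
      (\<lambda>j. \<integral>x. cmod (g (h j + x) - g x) \<partial>lborel) \<longlonglongrightarrow> 0"
  shows "(\<lambda>j. \<integral>x. cmod (f (h j + x) - f x) \<partial>lborel) \<longlonglongrightarrow> 0"
proof (rule LIMSEQ_I)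
  fix e :: real assume e: "e > 0"
  obtain g where g: "integrable lborel g" and fg: "(\<integral>x. cmod (f x - g x) \<partial>lborel) < e / 3"
    and lim: "(\<lambda>j. \<integral>x. cmod (g (h j + x) - g x) \<partial>lborel) \<longlonglongrightarrow> 0"
    using approx[of "e / 3"] e by auto
  obtain J where J: "\<And>j. j \<ge> J \<Longrightarrow> (\<integral>x. cmod (g (h j + x) - g x) \<partial>lborel) < e / 3"
    using LIMSEQ_D[OF lim, of "e / 3"] e by auto
  note ints = f g lborel_integrable_shift[OF f] lborel_integrable_shift[OF g]
  have [measurable]: "f \<in> borel_measurable borel" "g \<in> borel_measurable borel"
    using f g by (auto dest: borel_measurable_integrable)
  have "(\<integral>x. cmod (f (h j + x) - f x) \<partial>lborel) < e" if "j \<ge> J" for j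
  proof -
    have i: "integrable lborel (\<lambda>x. cmod (g (h j + x) - g x))"
      "integrable lborel (\<lambda>x. cmod (f (h j + x) - g (h j + x)))" "integrable lborel (\<lambda>x. cmod (f x - g x))"
      by (intro integrable_norm Bochner_Integration.integrable_diff ints)+
    have "(\<integral>x. cmod (f (h j + x) - f x) \<partial>lborel) \<le>
      (\<integral>x. cmod (f (h j + x) - g (h j + x)) + (cmod (g (h j + x) - g x) + cmod (f x - g x)) \<partial>lborel)"
    proof (rule integral_mono)
      show "integrable lborel (\<lambda>x. cmod (f (h j + x) - f x))"
        by (intro integrable_norm Bochner_Integration.integrable_diff ints)
      show "integrable lborel (\<lambda>x. cmod (f (h j + x) - g (h j + x)) + (cmod (g (h j + x) - g x) + cmod (f x - g x)))"
        by (intro Bochner_Integration.integrable_add i)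
      show "cmod (f (h j + x) - f x) \<le> cmod (f (h j + x) - g (h j + x)) + (cmod (g (h j + x) - g x) + cmod (f x - g x))" for x
        using norm_triangle_ineq[of "f (h j + x) - g (h j + x)" "g (h j + x) - f x"]
          norm_triangle_ineq[of "g (h j + x) - g x" "g x - f x"] by (simp add: norm_minus_commute)
    qed
    also have "\<dots> = (\<integral>x. cmod (f (h j + x) - g (h j + x)) \<partial>lborel) +
        ((\<integral>x. cmod (g (h j + x) - g x) \<partial>lborel) + (\<integral>x. cmod (f x - g x) \<partial>lborel))"
      using i by simp
    also have "(\<integral>x. cmod (f (h j + x) - g (h j + x)) \<partial>lborel) = (\<integral>x. cmod (f x - g x) \<partial>lborel)"
    proof -
      have "complex_of_real (\<integral>x. cmod (f x - g x) \<partial>lborel) =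
          complex_of_real (\<integral>x. cmod (f (h j + x) - g (h j + x)) \<partial>lborel)"
        using lborel_integral_affine[of "\<lambda>x. complex_of_real (cmod (f x - g x))" 1 "h j"] by simp
      then show ?thesis by (simp only: of_real_eq_iff)
    qed
    finally show ?thesis using fg J[OF that] by simp
  qed
  then show "\<exists>J. \<forall>j\<ge>J. norm ((\<integral>x. cmod (f (h j + x) - f x) \<partial>lborel) - 0) < e"
    by (intro exI[of _ J]) simp
qed

text \<open>For open \<open>U\<close> the indicator is lower semicontinuous, so the negative part of the increment tends
  to 0 boundedly; the positive part has the same integral.\<close>

lemma L1_translation_open:
  fixes U :: "'a::euclidean_space set" and c :: complex
  assumes U: "open U" and fin: "emeasure lborel U < \<infinity>" and h: "h \<longlonglongrightarrow> 0"
  shows "(\<lambda>j. \<integral>x. cmod (indicator U (h j + x) *\<^sub>R c - indicator U x *\<^sub>R c) \<partial>lborel) \<longlonglongrightarrow> 0"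
proof -
  have [measurable]: "U \<in> sets borel" using U by simp
  let ?g = "indicator U :: 'a \<Rightarrow> real"
  have ic: "integrable lborel (\<lambda>x. complex_of_real (?g x))"
    using fin by (intro integrable_of_real integrable_real_indicator) auto
  have i: "integrable lborel ?g" "integrable lborel (\<lambda>x. ?g (h j + x))" for j
    using fin integrable_Re[OF lborel_integrable_shift[OF ic, of "h j"]] by (auto intro: integrable_real_indicator)
  have lim: "(\<lambda>j. \<integral>x. max 0 (?g x - ?g (h j + x)) \<partial>lborel) \<longlonglongrightarrow> integral\<^sup>L lborel (\<lambda>_::'a. 0::real)"
  proof (rule integral_dominated_convergence)
    show "integrable lborel ?g" by (rule i)
    show "AE x in lborel. norm (max 0 (?g x - ?g (h j + x))) \<le> ?g x" for j
      by (intro AE_I2) (simp add: indicator_def)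
    show "AE x in lborel. (\<lambda>j. max 0 (?g x - ?g (h j + x))) \<longlonglongrightarrow> 0"
    proof (intro AE_I2 tendsto_eventually)
      fix x
      show "\<forall>\<^sub>F j in sequentially. max 0 (?g x - ?g (h j + x)) = 0"
      proof (cases "x \<in> U")
        case True
        have "(\<lambda>j. h j + x) \<longlonglongrightarrow> x" using tendsto_add[OF h tendsto_const[of x]] by simp
        from topological_tendstoD[OF this U True] show ?thesis by eventually_elim simp
      qed auto
    qed
  qed measurable
  have eq: "cmod (indicator U (h j + x) *\<^sub>R c - indicator U x *\<^sub>R c) =
      cmod c * (2 * max 0 (?g x - ?g (h j + x)) + (?g (h j + x) - ?g x))" for j x
    by (simp add: indicator_def)
  have "(\<integral>x. cmod (indicator U (h j + x) *\<^sub>R c - indicator U x *\<^sub>R c) \<partial>lborel) =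
      cmod c * (2 * (\<integral>x. max 0 (?g x - ?g (h j + x)) \<partial>lborel))" for j
  proof -
    have "complex_of_real (\<integral>x. ?g x \<partial>lborel) = complex_of_real (\<integral>x. ?g (h j + x) \<partial>lborel)"
      using lborel_integral_affine[of "\<lambda>x. complex_of_real (?g x)" 1 "h j"] by simp
    then have "(\<integral>x. ?g x \<partial>lborel) = (\<integral>x. ?g (h j + x) \<partial>lborel)" by (simp only: of_real_eq_iff)
    moreover have "integrable lborel (\<lambda>x. max 0 (?g x - ?g (h j + x)))"
      by (intro integrable_max Bochner_Integration.integrable_diff i) simp
    ultimately show ?thesis unfolding eq using i by simp
  qed
  moreover have "(\<lambda>j. cmod c * (2 * (\<integral>x. max 0 (?g x - ?g (h j + x)) \<partial>lborel))) \<longlonglongrightarrow> 0"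
    using tendsto_mult_left[OF tendsto_mult_left[OF lim, of 2], of "cmod c"] by simp
  ultimately show ?thesis by simp
qed

text \<open>Induction over integrable functions leaves indicators of sets of finite measure, and
  outer regularity replaces these by open sets.\<close>

lemma L1_translation_continuous:
  fixes f :: "'a::euclidean_space \<Rightarrow> complex"
  assumes "integrable lborel f" and h: "h \<longlonglongrightarrow> 0"
  shows "(\<lambda>j. \<integral>x. cmod (f (h j + x) - f x) \<partial>lborel) \<longlonglongrightarrow> 0"
  using assms(1)
proof induction
  case (base A c)
  then have A: "A \<in> sets lebesgue" "A \<in> sets borel" by auto
  have iA: "integrable lborel (\<lambda>x. indicator A x *\<^sub>R c)" using base by auto
  show ?case
  proof (rule L1_translation_approx[OF iA])
    fix e :: real assume e: "e > 0"
    \<comment> \<open>Adding 1 keeps the denominator positive for \<open>c = 0\<close> and makes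
      \<open>cmod c * d < e\<close> strict.\<close>
    define d where "d = e / (cmod c + 1)"
    have d: "d > 0" using e by (simp add: d_def add_nonneg_pos)
    obtain U where U: "open U" "A \<subseteq> U" "U - A \<in> lmeasurable" "emeasure lebesgue (U - A) < ennreal d"
      using sets_lebesgue_outer_open[OF A(1) d] by metis
    have UA: "U - A \<in> sets borel" using U(1) A(2) by auto
    have emUA: "emeasure lborel (U - A) < ennreal d" using U(4) UA by simp
    have "emeasure lborel U = emeasure lborel A + emeasure lborel (U - A)"
      using UA A U(2) by (subst plus_emeasure) (auto simp: Un_absorb1)
    then have finU: "emeasure lborel U < \<infinity>" using base(2) emUA by (auto simp: less_top[symmetric] dest: order.strict_trans)
    have "(\<integral>x. cmod (indicator A x *\<^sub>R c - indicator U x *\<^sub>R c) \<partial>lborel) = (\<integral>x. cmod c * indicator (U - A) x \<partial>lborel)"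
      using U(2) by (intro Bochner_Integration.integral_cong) (auto simp: indicator_def)
    also have "\<dots> = cmod c * measure lborel (U - A)" using UA by simp
    also have "\<dots> \<le> cmod c * d"
    proof (intro mult_left_mono)
      have "emeasure lborel (U - A) = ennreal (measure lborel (U - A))"
        using emUA by (intro emeasure_eq_ennreal_measure) auto
      then show "measure lborel (U - A) \<le> d" using emUA d by (simp add: ennreal_less_iff)
    qed simp
    also have "\<dots> < e" using e add_nonneg_pos[OF norm_ge_zero[of c] zero_less_one]
      unfolding d_def times_divide_eq_right by (subst pos_divide_less_eq) (auto simp: algebra_simps)
    finally have "(\<integral>x. cmod (indicator A x *\<^sub>R c - indicator U x *\<^sub>R c) \<partial>lborel) < e" .
    then show "\<exists>g. integrable lborel g \<and> (\<integral>x. cmod (indicator A x *\<^sub>R c - g x) \<partial>lborel) < e \<and>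
        (\<lambda>j. \<integral>x. cmod (g (h j + x) - g x) \<partial>lborel) \<longlonglongrightarrow> 0"
      using L1_translation_open[OF U(1) finU h, of c] finU U(1)
      by (intro exI[of _ "\<lambda>x. indicator U x *\<^sub>R c"]) auto
  qed
next
  case (add f g)
  note i = add.hyps lborel_integrable_shift[OF add.hyps(1)] lborel_integrable_shift[OF add.hyps(2)]
  show ?case
  proof (rule tendsto_sandwich[OF _ _ tendsto_const])
    show "(\<lambda>j. (\<integral>x. cmod (f (h j + x) - f x) \<partial>lborel) + (\<integral>x. cmod (g (h j + x) - g x) \<partial>lborel)) \<longlonglongrightarrow> 0"
      using tendsto_add[OF add.IH] by simp
    have "(\<integral>x. cmod (f (h j + x) + g (h j + x) - (f x + g x)) \<partial>lborel) \<le>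
        (\<integral>x. cmod (f (h j + x) - f x) + cmod (g (h j + x) - g x) \<partial>lborel)" for j
      using norm_triangle_ineq[of "f (h j + x) - f x" "g (h j + x) - g x" for x]
      by (intro integral_mono integrable_norm Bochner_Integration.integrable_diff Bochner_Integration.integrable_add i)
         (simp add: algebra_simps)
    then show "\<forall>\<^sub>F j in sequentially. (\<integral>x. cmod (f (h j + x) + g (h j + x) - (f x + g x)) \<partial>lborel) \<le>
        (\<integral>x. cmod (f (h j + x) - f x) \<partial>lborel) + (\<integral>x. cmod (g (h j + x) - g x) \<partial>lborel)"
      using i by simp
  qed simp
next
  case (lim f s)
  note [measurable] = borel_measurable_integrable[OF lim.hyps(1)] borel_measurable_integrable[OF lim.hyps(4)]
  have c: "(\<lambda>i. \<integral>x. cmod (f x - s i x) \<partial>lborel) \<longlonglongrightarrow> integral\<^sup>L lborel (\<lambda>_::'a. 0::real)"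
  proof (rule integral_dominated_convergence)
    \<comment> \<open>The approximants satisfy \<open>cmod (s i x) \<le> 2 * cmod (f x)\<close>, so
      the difference is at most three times \<open>cmod (f x)\<close>.\<close>
    show "integrable lborel (\<lambda>x. 3 * cmod (f x))" using lim.hyps(4) by simp
    show "AE x in lborel. norm (cmod (f x - s i x)) \<le> 3 * cmod (f x)" for i
      using lim.hyps(3)[of _ i] norm_triangle_ineq4[of "f x" "s i x" for x]
      by (intro AE_I2) (simp, smt (verit))
    show "AE x in lborel. (\<lambda>i. cmod (f x - s i x)) \<longlonglongrightarrow> 0"
      using lim.hyps(2) by (intro AE_I2) (auto intro!: tendsto_eq_intros)
  qed measurable
  show ?case
  proof (rule L1_translation_approx[OF lim.hyps(4)])
    fix e :: real assume "e > 0"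
    then obtain i where "(\<integral>x. cmod (f x - s i x) \<partial>lborel) < e"
      using LIMSEQ_D[OF c, of e] by auto
    with lim.hyps(1) lim.IH show "\<exists>g. integrable lborel g \<and> (\<integral>x. cmod (f x - g x) \<partial>lborel) < e \<and>
        (\<lambda>j. \<integral>x. cmod (g (h j + x) - g x) \<partial>lborel) \<longlonglongrightarrow> 0" by blast
  qed
qed

lemma nn_integral_translation_tendsto_0:
  fixes f :: "'a::euclidean_space \<Rightarrow> complex"
  assumes "integrable lborel f" "h \<longlonglongrightarrow> 0"
  shows "(\<lambda>j. \<integral>\<^sup>+x. cmod (f (h j + x) - f x) \<partial>lborel) \<longlonglongrightarrow> 0"
proof -
  have "(\<integral>\<^sup>+x. cmod (f (h j + x) - f x) \<partial>lborel) = ennreal (\<integral>x. cmod (f (h j + x) - f x) \<partial>lborel)" for j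
    by (intro nn_integral_eq_integral integrable_norm Bochner_Integration.integrable_diff
        lborel_integrable_shift assms) auto
  then show ?thesis
    using tendsto_ennrealI[OF L1_translation_continuous[OF assms]] by simp
qed

section \<open>Polynomial weights and the kernel average\<close>

lemma one_plus_norm_add_le:
  fixes x y :: "'a::real_normed_vector"
  shows "1 + norm (x + y) \<le> (1 + norm x) * (1 + norm y)"
proof -
  have "norm (x + y) \<le> norm x + norm y" by (rule norm_triangle_ineq)
  moreover have "0 \<le> norm x * norm y" by simp
  ultimately have "norm (x + y) \<le> norm x + norm y + norm x * norm y" by linarith
  then show ?thesis by (simp add: algebra_simps)
qed

text \<open>As \<open>1 + norm x \<ge> 1\<close> and \<open>\<sigma> \<le> N\<close>, the factor
  \<open>(1 + norm x) powr (N - \<sigma>)\<close> is at least 1. Replacing a real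
  \<open>\<sigma>\<close> of any sign by a natural \<open>N\<close> lets all growth be measured by
  ordinary powers.\<close>

lemma weight_le:
  fixes x :: "'a::real_normed_vector"
  assumes "\<sigma> \<le> real N" "1 + norm x \<le> r" "0 \<le> c"
  shows "c \<le> r ^ N * ((1 + norm x) powr (- \<sigma>) * c)"
proof -
  have p: "1 + norm x > 0" by (simp add: add_pos_nonneg)
  have "1 \<le> (1 + norm x) powr (real N - \<sigma>)" using assms by (intro ge_one_powr_ge_zero) auto
  also have "\<dots> = (1 + norm x) ^ N * (1 + norm x) powr (- \<sigma>)"
    using p by (simp add: powr_diff powr_minus powr_realpow divide_inverse)
  also have "\<dots> \<le> r ^ N * (1 + norm x) powr (- \<sigma>)"
    using assms by (intro mult_right_mono power_mono) auto
  finally have "c * 1 \<le> c * (r ^ N * (1 + norm x) powr (- \<sigma>))"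
    using assms(3) by (rule mult_left_mono)
  then show ?thesis by (simp add: mult_ac)
qed

text \<open>The integral over \<open>\<eta>\<close> in a ball tends to 0 by Tonelli and continuity of translations in
  \<open>L\<^sup>1\<close>; Fatou's lemma then handles the sequence \<open>R\<close> without passing to a subsequence.\<close>

lemma AE_liminf_kernel_0:
  fixes a :: "'a::euclidean_space \<Rightarrow> complex" and K :: "'a \<Rightarrow> real"
  assumes [measurable]: "a \<in> borel_measurable borel" "K \<in> borel_measurable borel"
    and a: "(\<integral>\<^sup>+\<xi>. ennreal ((1 + norm \<xi>) powr (- \<sigma>) * cmod (a \<xi>)) \<partial>lborel) < \<infinity>"
    and \<sigma>: "\<sigma> \<le> real N"
    and K0: "\<And>\<zeta>. 0 \<le> K \<zeta>" and K: "integrable lborel (\<lambda>\<zeta>. (1 + norm \<zeta>) ^ N * K \<zeta>)"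
    and r: "\<And>j. 0 \<le> r j" "\<And>j. r j \<le> 1" "r \<longlonglongrightarrow> 0"
  shows "AE \<eta> in lborel. liminf (\<lambda>j. \<integral>\<^sup>+\<zeta>. ennreal (cmod (a (r j *\<^sub>R \<zeta> + \<eta>) - a \<eta>) * K \<zeta>) \<partial>lborel) = 0"
proof -
  define \<epsilon> where "\<epsilon> j \<eta> = (\<integral>\<^sup>+\<zeta>. ennreal (cmod (a (r j *\<^sub>R \<zeta> + \<eta>) - a \<eta>) * K \<zeta>) \<partial>lborel)" for j \<eta>
  have m\<epsilon>[measurable]: "\<epsilon> j \<in> borel_measurable lborel" for j unfolding \<epsilon>_def by measurable
  define w where "w \<xi> = (1 + norm \<xi>) powr (- \<sigma>) * cmod (a \<xi>)" for \<xi>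
  have [measurable]: "w \<in> borel_measurable borel" unfolding w_def by measurable
  have w0: "0 \<le> w \<xi>" for \<xi> by (simp add: w_def)
  define A where "A = (\<integral>\<^sup>+\<xi>. ennreal (w \<xi>) \<partial>lborel)"
  have A: "A < \<infinity>" using a by (simp add: A_def w_def)
  have ball: "AE \<eta> in lborel. indicator (ball 0 m) \<eta> * liminf (\<lambda>j. \<epsilon> j \<eta>) = 0" if m: "m \<ge> 0" for m :: real
  proof -
    define G where "G h = (\<integral>\<^sup>+\<eta>. ennreal (cmod (a (h + \<eta>) - a \<eta>)) * indicator (ball 0 m) \<eta> \<partial>lborel)" for h
    have [measurable]: "ball (0::'a) m \<in> sets borel" "ball (0::'a) (m + 1) \<in> sets borel" by auto
    have [measurable]: "G \<in> borel_measurable borel" unfolding G_def by measurable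
    \<comment> \<open>For \<open>norm h < 1\<close> and \<open>\<eta>\<close> in the ball of radius
      \<open>m\<close>, the point \<open>h + \<eta>\<close> stays in the ball of radius
      \<open>m + 1\<close>, where \<open>f\<close> agrees with \<open>a\<close>. Thus
      \<open>G\<close> is controlled by translations of an integrable function.\<close>
    define f where "f \<xi> = indicator (ball 0 (m + 1)) \<xi> *\<^sub>R a \<xi>" for \<xi>
    have f: "integrable lborel f"
    proof (rule integrableI_bounded)
      show "f \<in> borel_measurable lborel" unfolding f_def by measurable
      have "norm (f \<xi>) \<le> (m + 2) ^ N * w \<xi>" for \<xi>
        using weight_le[OF \<sigma>, of \<xi> "m + 2" "cmod (a \<xi>)"] w0[of \<xi>] m
        by (auto simp: f_def indicator_def w_def)
      then have "(\<integral>\<^sup>+\<xi>. ennreal (norm (f \<xi>)) \<partial>lborel) \<le> (\<integral>\<^sup>+\<xi>. ennreal ((m + 2) ^ N) * ennreal (w \<xi>) \<partial>lborel)"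
        using m w0 by (intro nn_integral_mono) (simp flip: ennreal_mult add: ennreal_leI)
      also have "\<dots> = ennreal ((m + 2) ^ N) * A" unfolding A_def by (rule nn_integral_cmult) measurable
      also have "\<dots> < \<infinity>" using A by (simp add: ennreal_mult_less_top)
      finally show "(\<integral>\<^sup>+\<xi>. ennreal (norm (f \<xi>)) \<partial>lborel) < \<infinity>" .
    qed
    have G_lim: "(\<lambda>j. G (h j)) \<longlonglongrightarrow> 0" if h: "h \<longlonglongrightarrow> 0" for h
    proof (rule tendsto_sandwich[OF _ _ tendsto_const nn_integral_translation_tendsto_0[OF f h]])
      have "\<forall>\<^sub>F j in sequentially. norm (h j) < 1"
        using tendstoD[OF h, of 1] by simp
      then show "\<forall>\<^sub>F j in sequentially. G (h j) \<le> (\<integral>\<^sup>+x. ennreal (cmod (f (h j + x) - f x)) \<partial>lborel)"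
      proof eventually_elim
        case (elim j)
        show ?case unfolding G_def
        proof (intro nn_integral_mono)
          fix \<eta>
          have "norm (h j + \<eta>) < m + 1" if "norm \<eta> < m" using norm_triangle_ineq[of "h j" \<eta>] elim that by simp
          then show "ennreal (cmod (a (h j + \<eta>) - a \<eta>)) * indicator (ball 0 m) \<eta> \<le> ennreal (cmod (f (h j + \<eta>) - f \<eta>))"
            by (auto simp: f_def indicator_def)
        qed
      qed
    qed simp
    define C where "C = (1 + m) ^ N"
    have C0: "C \<ge> 0" using m by (simp add: C_def)
    \<comment> \<open>Large shifts leave every fixed ball, so the truncation \<open>f\<close> is
      useless here. Submultiplicativity of the weight gives polynomial growth instead; the shifted
      and the unshifted term contribute one \<open>A\<close> each.\<close>
    have G_bound: "G h \<le> ennreal ((1 + norm h) ^ N * C) * (A + A)" for h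
    proof -
      let ?c = "(1 + norm h) ^ N * C"
      have c0: "?c \<ge> 0" using C0 by simp
      have "G h \<le> (\<integral>\<^sup>+\<eta>. ennreal ?c * (ennreal (w (h + \<eta>)) + ennreal (w \<eta>)) \<partial>lborel)"
        unfolding G_def
      proof (intro nn_integral_mono)
        fix \<eta>
        have "cmod (a (h + \<eta>) - a \<eta>) \<le> ?c * (w (h + \<eta>) + w \<eta>)" if \<eta>: "norm \<eta> < m"
        proof -
          have le: "1 + norm (h + \<eta>) \<le> (1 + norm h) * (1 + m)"
            using order_trans[OF one_plus_norm_add_le[of h \<eta>] mult_left_mono[of "1 + norm \<eta>" "1 + m" "1 + norm h"]] \<eta> by simp
          have "1 + norm \<eta> \<le> 1 * (1 + m)" using \<eta> by simp
          also have "\<dots> \<le> (1 + norm h) * (1 + m)" using m by (intro mult_right_mono) auto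
          finally have le2: "1 + norm \<eta> \<le> (1 + norm h) * (1 + m)" .
          have "cmod (a (h + \<eta>) - a \<eta>) \<le> cmod (a (h + \<eta>)) + cmod (a \<eta>)" by (rule norm_triangle_ineq4)
          also have "\<dots> \<le> ?c * w (h + \<eta>) + ?c * w \<eta>"
            using weight_le[OF \<sigma> le, of "cmod (a (h + \<eta>))"] weight_le[OF \<sigma> le2, of "cmod (a \<eta>)"]
            by (simp add: C_def w_def power_mult_distrib)
          finally show ?thesis by (simp add: algebra_simps)
        qed
        then show "ennreal (cmod (a (h + \<eta>) - a \<eta>)) * indicator (ball 0 m) \<eta> \<le>
            ennreal ?c * (ennreal (w (h + \<eta>)) + ennreal (w \<eta>))"
          using w0 c0 by (auto simp: indicator_def ennreal_leI simp flip: ennreal_plus ennreal_mult)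
      qed
      also have "\<dots> = ennreal ?c * ((\<integral>\<^sup>+\<eta>. ennreal (w (h + \<eta>)) \<partial>lborel) + A)"
        unfolding A_def by (simp add: nn_integral_cmult nn_integral_add)
      also have "(\<integral>\<^sup>+\<eta>. ennreal (w (h + \<eta>)) \<partial>lborel) = A"
        using lborel_nn_integral_affine[of "\<lambda>x. ennreal (w x)" 1 h] by (simp add: A_def)
      finally show ?thesis .
    qed
    have Tonelli: "(\<integral>\<^sup>+\<eta>. indicator (ball 0 m) \<eta> * \<epsilon> j \<eta> \<partial>lborel) = (\<integral>\<^sup>+\<zeta>. ennreal (K \<zeta>) * G (r j *\<^sub>R \<zeta>) \<partial>lborel)" for j
    proof -
      have "(\<integral>\<^sup>+\<eta>. indicator (ball 0 m) \<eta> * \<epsilon> j \<eta> \<partial>lborel) =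
          (\<integral>\<^sup>+\<eta>. \<integral>\<^sup>+\<zeta>. indicator (ball 0 m) \<eta> * ennreal (cmod (a (r j *\<^sub>R \<zeta> + \<eta>) - a \<eta>) * K \<zeta>) \<partial>lborel \<partial>lborel)"
        unfolding \<epsilon>_def by (intro nn_integral_cong nn_integral_cmult[symmetric]) measurable
      also have "\<dots> = (\<integral>\<^sup>+\<zeta>. \<integral>\<^sup>+\<eta>. indicator (ball 0 m) \<eta> * ennreal (cmod (a (r j *\<^sub>R \<zeta> + \<eta>) - a \<eta>) * K \<zeta>) \<partial>lborel \<partial>lborel)"
        by (rule lborel_pair.Fubini') measurable
      also have "\<dots> = (\<integral>\<^sup>+\<zeta>. ennreal (K \<zeta>) * G (r j *\<^sub>R \<zeta>) \<partial>lborel)"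
        unfolding G_def
        by (intro nn_integral_cong, subst nn_integral_cmult[symmetric])
           (auto simp: ennreal_mult K0 mult_ac)
      finally show ?thesis .
    qed
    have "(\<lambda>j. \<integral>\<^sup>+\<zeta>. ennreal (K \<zeta>) * G (r j *\<^sub>R \<zeta>) \<partial>lborel) \<longlonglongrightarrow> integral\<^sup>N lborel (\<lambda>_::'a. 0)"
    proof (rule nn_integral_dominated_convergence)
      \<comment> \<open>Because \<open>r j \<le> 1\<close>, the bound on
        \<open>G (r j *\<^sub>R \<zeta>)\<close> does not depend on \<open>j\<close>, and its growth
        \<open>(1 + norm \<zeta>) ^ N\<close> is exactly what the moment hypothesis on
        \<open>K\<close> absorbs.\<close>
      let ?w = "\<lambda>\<zeta>. ennreal ((1 + norm \<zeta>) ^ N * K \<zeta>) * (ennreal C * (A + A))"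
      show "?w \<in> borel_measurable lborel" by measurable
      have "(\<integral>\<^sup>+\<zeta>. ?w \<zeta> \<partial>lborel) = (\<integral>\<^sup>+\<zeta>. ennreal ((1 + norm \<zeta>) ^ N * K \<zeta>) \<partial>lborel) * (ennreal C * (A + A))"
        by (rule nn_integral_multc) measurable
      also have "\<dots> < \<infinity>"
        using K A K0 by (simp add: nn_integral_eq_integral ennreal_mult_less_top)
      finally show "(\<integral>\<^sup>+\<zeta>. ?w \<zeta> \<partial>lborel) < \<infinity>" .
      show "AE \<zeta> in lborel. ennreal (K \<zeta>) * G (r j *\<^sub>R \<zeta>) \<le> ?w \<zeta>" for j
      proof (intro AE_I2)
        fix \<zeta> :: 'a
        have "norm (r j *\<^sub>R \<zeta>) \<le> norm \<zeta>" using r(1,2)[of j] by (simp add: mult_left_le_one_le)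
        then have le: "(1 + norm (r j *\<^sub>R \<zeta>)) ^ N * C \<le> (1 + norm \<zeta>) ^ N * C"
          using C0 by (intro mult_right_mono power_mono) auto
        have "G (r j *\<^sub>R \<zeta>) \<le> ennreal ((1 + norm \<zeta>) ^ N * C) * (A + A)"
          by (rule order_trans[OF G_bound mult_right_mono[OF ennreal_leI[OF le]]]) simp
        then have "ennreal (K \<zeta>) * G (r j *\<^sub>R \<zeta>) \<le> ennreal (K \<zeta>) * (ennreal ((1 + norm \<zeta>) ^ N * C) * (A + A))"
          by (intro mult_left_mono) auto
        then show "ennreal (K \<zeta>) * G (r j *\<^sub>R \<zeta>) \<le> ?w \<zeta>"
          using K0[of \<zeta>] C0 by (simp add: ennreal_mult mult_ac)
      qed
      show "AE \<zeta> in lborel. (\<lambda>j. ennreal (K \<zeta>) * G (r j *\<^sub>R \<zeta>)) \<longlonglongrightarrow> 0"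
      proof (intro AE_I2)
        fix \<zeta> :: 'a
        have "(\<lambda>j. r j *\<^sub>R \<zeta>) \<longlonglongrightarrow> 0" using tendsto_scaleR[OF r(3) tendsto_const[of \<zeta>]] by simp
        from ennreal_tendsto_cmult[OF _ G_lim[OF this], of "ennreal (K \<zeta>)"]
        show "(\<lambda>j. ennreal (K \<zeta>) * G (r j *\<^sub>R \<zeta>)) \<longlonglongrightarrow> 0" by simp
      qed
    qed measurable
    then have "liminf (\<lambda>j. \<integral>\<^sup>+\<eta>. indicator (ball 0 m) \<eta> * \<epsilon> j \<eta> \<partial>lborel) = 0"
      unfolding Tonelli by (intro lim_imp_Liminf) auto
    moreover have "(\<integral>\<^sup>+\<eta>. liminf (\<lambda>j. indicator (ball 0 m) \<eta> * \<epsilon> j \<eta>) \<partial>lborel) \<le>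
        liminf (\<lambda>j. \<integral>\<^sup>+\<eta>. indicator (ball 0 m) \<eta> * \<epsilon> j \<eta> \<partial>lborel)"
      by (intro nn_integral_liminf) measurable
    ultimately have "(\<integral>\<^sup>+\<eta>. liminf (\<lambda>j. indicator (ball 0 m) \<eta> * \<epsilon> j \<eta>) \<partial>lborel) = 0" by simp
    then have "AE \<eta> in lborel. liminf (\<lambda>j. indicator (ball 0 m) \<eta> * \<epsilon> j \<eta>) = 0"
      by (subst (asm) nn_integral_0_iff_AE) measurable
    then show ?thesis
      by eventually_elim (auto simp: indicator_def)
  qed
  have "AE \<eta> in lborel. \<forall>m::nat. indicator (ball 0 (real m)) \<eta> * liminf (\<lambda>j. \<epsilon> j \<eta>) = 0"
    unfolding AE_all_countable by (intro allI ball) simp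
  then show ?thesis
  proof eventually_elim
    case (elim \<eta>)
    obtain m :: nat where "norm \<eta> < real m" using reals_Archimedean2 by blast
    with elim[rule_format, of m] show ?case by (simp add: \<epsilon>_def)
  qed
qed

section \<open>Cutoffs and the fundamental lemma of the calculus of variations\<close>

lemma elem_smooth_affine:
  assumes "elem_smooth f"
  shows "elem_smooth (\<lambda>x. f (c *\<^sub>R x + v))"
  using assms
proof induction
  case (linear w)
  have "(\<lambda>x. complex_of_real ((c *\<^sub>R x + v) \<bullet> w)) =
      (\<lambda>x. complex_of_real c * complex_of_real (x \<bullet> w) + complex_of_real (v \<bullet> w))"
    by (simp add: inner_add_left)
  then show ?case by (simp only:) (intro elem_smooth.intros)
qed (auto intro: elem_smooth.intros)

lemma elem_smooth_sum: "(\<And>i. i \<in> I \<Longrightarrow> elem_smooth (f i)) \<Longrightarrow> elem_smooth (\<lambda>x. \<Sum>i\<in>I. f i x)"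
  by (induction I rule: infinite_finite_induct) (auto intro: elem_smooth.intros)

lemma elem_smooth_prod: "(\<And>i. i \<in> I \<Longrightarrow> elem_smooth (f i)) \<Longrightarrow> elem_smooth (\<lambda>x. \<Prod>i\<in>I. f i x)"
  by (induction I rule: infinite_finite_induct) (auto intro: elem_smooth.intros)

lemma elem_smooth_norm_sq: "elem_smooth (\<lambda>x. complex_of_real ((norm x)\<^sup>2))"
proof -
  have "(\<lambda>x::'a. complex_of_real ((norm x)\<^sup>2)) =
      (\<lambda>x. \<Sum>b\<in>Basis. complex_of_real (x \<bullet> b) * complex_of_real (x \<bullet> b))"
    unfolding power2_norm_eq_inner by (subst euclidean_inner) simp
  then show ?thesis by (simp only:) (intro elem_smooth_sum elem_smooth.intros)
qed

lemma elem_smooth_flat_exp: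
  assumes "elem_smooth (\<lambda>x. complex_of_real (f x))"
  shows "elem_smooth (\<lambda>x. complex_of_real (flat_exp p (f x)))"
  using elem_smooth.flat[OF assms] by simp

lemma flat_exp_1_bounds: "0 \<le> flat_exp 1 t" "flat_exp 1 t \<le> 1" "0 < flat_exp 1 t \<longleftrightarrow> 0 < t"
  by (auto simp: flat_exp_def)

lemma flat_exp_1_nonpos: "t \<le> 0 \<Longrightarrow> flat_exp 1 t = 0"
  by (simp add: flat_exp_def)

text \<open>The quotient \<open>p / (p + q)\<close>: \<open>p\<close> is positive exactly for
  \<open>norm x < s\<close> and \<open>q\<close> exactly for \<open>norm x > 1\<close>, so
  \<open>s > 1\<close> keeps the denominator positive everywhere. Squared norms keep both smooth at
  the origin.\<close>

lemma cutoff_exists: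
  fixes s :: real
  assumes s: "s > 1"
  obtains \<psi> :: "'a::euclidean_space \<Rightarrow> complex" where "elem_test \<psi>"
    "\<And>x. norm x \<le> 1 \<Longrightarrow> \<psi> x = 1" "\<And>x. norm x \<ge> s \<Longrightarrow> \<psi> x = 0" "\<And>x. cmod (\<psi> x) \<le> 1"
proof
  define p where "p x = flat_exp 1 (s\<^sup>2 - (norm x)\<^sup>2)" for x :: 'a
  define q where "q x = flat_exp 1 ((norm x)\<^sup>2 - 1)" for x :: 'a
  let ?\<psi> = "\<lambda>x. complex_of_real (p x) * inverse (complex_of_real (p x) + complex_of_real (q x))"
  have pq: "p x + q x > 0" for x
  proof (cases "norm x < s")
    case True
    then have "(norm x)\<^sup>2 < s\<^sup>2" using s by (intro power_strict_mono) auto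
    then have "p x > 0" by (simp add: p_def flat_exp_1_bounds)
    then show ?thesis using flat_exp_1_bounds(1) by (simp add: q_def add_pos_nonneg)
  next
    case False
    then have "1 < (norm x)\<^sup>2" using s by (intro one_less_power) auto
    then have "q x > 0" by (simp add: q_def flat_exp_1_bounds)
    then show ?thesis using flat_exp_1_bounds(1) by (simp add: p_def add_nonneg_pos)
  qed
  have psi_real: "?\<psi> x = complex_of_real (p x / (p x + q x))" for x
    by (simp add: divide_inverse)
  have "elem_smooth (\<lambda>x::'a. complex_of_real (s\<^sup>2) + (- 1) * complex_of_real ((norm x)\<^sup>2))"
    "elem_smooth (\<lambda>x::'a. complex_of_real ((norm x)\<^sup>2) + (- 1))"
    by (intro elem_smooth.intros elem_smooth_norm_sq)+
  then have sm: "elem_smooth (\<lambda>x. complex_of_real (p x))" "elem_smooth (\<lambda>x. complex_of_real (q x))"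
    unfolding p_def q_def by (auto intro!: elem_smooth_flat_exp)
  have nz: "complex_of_real (p x) + complex_of_real (q x) \<noteq> 0" for x
    using pq[of x] by (metis of_real_add of_real_eq_0_iff less_irrefl)
  show z: "?\<psi> x = 0" if "norm x \<ge> s" for x
  proof -
    have "s\<^sup>2 \<le> (norm x)\<^sup>2" using that s by (intro power_mono) auto
    then show ?thesis by (simp add: p_def flat_exp_1_nonpos)
  qed
  have "{x. ?\<psi> x \<noteq> 0} \<subseteq> ball 0 s"
    using z by (intro subsetI) (auto simp: not_le[symmetric])
  then have "bounded {x. ?\<psi> x \<noteq> 0}" by (rule bounded_subset[OF bounded_ball])
  moreover have "elem_smooth ?\<psi>"
    by (intro elem_smooth.mult elem_smooth.inverse elem_smooth.add sm nz)
  ultimately show "elem_test ?\<psi>" by (simp add: elem_test_def)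
  show "?\<psi> x = 1" if "norm x \<le> 1" for x
  proof -
    have "q x = 0" using that by (simp add: q_def flat_exp_1_nonpos power_le_one)
    then show ?thesis using pq[of x] by simp
  qed
  show "cmod (?\<psi> x) \<le> 1" for x
    unfolding psi_real norm_of_real using pq[of x] flat_exp_1_bounds(1)
    by (simp add: p_def q_def)
qed

text \<open>On the positive half-line \<open>exp (- 1 / (k * t))\<close> tends to 1 as
  \<open>k\<close> grows, while it is extended by 0 to the rest. One such factor for each face
  approximates the indicator of the open box from inside.\<close>

lemma box_bump:
  fixes l u :: "'a::euclidean_space"
  obtains \<phi> :: "nat \<Rightarrow> 'a \<Rightarrow> complex" where "\<And>k. elem_test (\<phi> k)"
    "\<And>k x. cmod (\<phi> k x) \<le> indicator (box l u) x" "\<And>x. (\<lambda>k. \<phi> k x) \<longlonglongrightarrow> indicator (box l u) x"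
proof
  define E where "E k t = flat_exp 1 (real (Suc k) * t)" for k t
  let ?\<phi> = "\<lambda>k x. \<Prod>b\<in>Basis. complex_of_real (E k ((x - l) \<bullet> b)) * complex_of_real (E k ((u - x) \<bullet> b))"
  have E: "0 \<le> E k t" "E k t \<le> 1" for k t by (simp_all add: E_def flat_exp_1_bounds)
  have E0: "E k t = 0" if "t \<le> 0" for k t
    using that unfolding E_def by (intro flat_exp_1_nonpos mult_nonneg_nonpos) auto
  have E1: "(\<lambda>k. E k t) \<longlonglongrightarrow> 1" if "t > 0" for t
  proof -
    have "(\<lambda>k. exp (- (inverse (real (Suc k)) / t))) \<longlonglongrightarrow> exp (- (0 / t))"
      using that by (intro tendsto_intros LIMSEQ_inverse_real_of_nat) auto
    moreover have "E k t = exp (- (inverse (real (Suc k)) / t))" for k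
      using that by (simp add: E_def flat_exp_def divide_inverse zero_less_mult_iff del: of_nat_Suc)
    ultimately show ?thesis by simp
  qed
  have out: "?\<phi> k x = 0" if "x \<notin> box l u" for k x
  proof -
    from that obtain b where "b \<in> Basis" "(x - l) \<bullet> b \<le> 0 \<or> (u - x) \<bullet> b \<le> 0"
      by (auto simp: mem_box inner_diff_left not_less)
    then show ?thesis by (intro prod_zero bexI[of _ b]) (auto simp: E0)
  qed
  have le1: "cmod (?\<phi> k x) \<le> 1" for k x
    unfolding prod_norm[symmetric] by (intro prod_le_1) (auto simp: norm_mult E intro!: mult_le_one)
  show "cmod (?\<phi> k x) \<le> indicator (box l u) x" for k x
    using le1 out by (cases "x \<in> box l u") auto
  show "(\<lambda>k. ?\<phi> k x) \<longlonglongrightarrow> indicator (box l u) x" for x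
  proof (cases "x \<in> box l u")
    case True
    then have pos: "(x - l) \<bullet> b > 0" "(u - x) \<bullet> b > 0" if "b \<in> Basis" for b
      using that by (auto simp: mem_box inner_diff_left)
    have "(\<lambda>k. ?\<phi> k x) \<longlonglongrightarrow> (\<Prod>b\<in>(Basis::'a set). of_real 1 * of_real 1)"
      by (intro tendsto_prod tendsto_mult tendsto_of_real E1 pos)
    then show ?thesis using True by simp
  next
    case False
    then show ?thesis by (simp add: out)
  qed
  show "elem_test (?\<phi> k)" for k
  proof -
    have "{x. ?\<phi> k x \<noteq> 0} \<subseteq> box l u" using out by blast
    then have "bounded {x. ?\<phi> k x \<noteq> 0}" by (rule bounded_subset[OF bounded_box])
    moreover have "elem_smooth (\<lambda>x. complex_of_real (E k ((x - l) \<bullet> b)))"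
      "elem_smooth (\<lambda>x. complex_of_real (E k ((u - x) \<bullet> b)))" for b
    proof -
      have "elem_smooth (\<lambda>x::'a. complex_of_real (real (Suc k)) * (complex_of_real (x \<bullet> b) + complex_of_real (- (l \<bullet> b))))"
        "elem_smooth (\<lambda>x::'a. complex_of_real (real (Suc k)) * (complex_of_real (u \<bullet> b) + (- 1) * complex_of_real (x \<bullet> b)))"
        by (intro elem_smooth.intros)+
      then show "elem_smooth (\<lambda>x. complex_of_real (E k ((x - l) \<bullet> b)))"
        "elem_smooth (\<lambda>x. complex_of_real (E k ((u - x) \<bullet> b)))"
        unfolding E_def by (auto intro!: elem_smooth_flat_exp simp: inner_diff_left algebra_simps simp del: of_nat_Suc)
    qed
    ultimately show ?thesis
      unfolding elem_test_def by (intro conjI elem_smooth_prod elem_smooth.mult)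
  qed
qed

text \<open>The hypotheses force all integrals of \<open>w\<close> over boxes to vanish, so Lebesgue differentiation applies.\<close>

lemma AE_eq_0_if_orthogonal_to_tests:
  fixes w :: "'a::euclidean_space \<Rightarrow> complex"
  assumes [measurable]: "w \<in> borel_measurable lebesgue"
    and int: "\<And>\<phi>. elem_test \<phi> \<Longrightarrow> integrable lebesgue (\<lambda>x. w x * \<phi> x)"
    and zero: "\<And>\<phi>. elem_test \<phi> \<Longrightarrow> (\<integral>x. w x * \<phi> x \<partial>lebesgue) = 0"
  shows "AE x in lebesgue. w x = 0"
proof -
  have box: "set_integrable lebesgue (box l u) w" "(LINT x:box l u|lebesgue. w x) = 0" for l u
  proof -
    have [measurable]: "box l u \<in> sets lebesgue" by simp
    obtain R where R: "R > 0" "\<And>x. x \<in> box l u \<Longrightarrow> norm x \<le> R"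
      using bounded_box[of l u] unfolding bounded_pos by blast
    obtain \<psi> :: "'a \<Rightarrow> complex" where \<psi>: "elem_test \<psi>" "\<And>x. norm x \<le> 1 \<Longrightarrow> \<psi> x = 1"
      "\<And>x. norm x \<ge> 2 \<Longrightarrow> \<psi> x = 0"
      using cutoff_exists[of 2] by (metis one_less_numeral_iff semiring_norm(76))
    \<comment> \<open>A test function equal to 1 on the box makes \<open>w\<close> integrable there
      and provides a majorant for all \<open>w x * \<phi> k x\<close>. The summand 0 matches the
      form of \<open>elem_smooth_affine\<close>.\<close>
    let ?\<chi> = "\<lambda>x. \<psi> ((1 / R) *\<^sub>R x + 0)"
    have "norm x \<le> 2 * R" if "?\<chi> x \<noteq> 0" for x
    proof -
      have "\<not> 2 \<le> norm ((1 / R) *\<^sub>R x + 0)" using \<psi>(3) that by blast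
      then show ?thesis using R(1) by (simp add: field_simps)
    qed
    then have "bounded {x. ?\<chi> x \<noteq> 0}" by (intro boundedI[where B="2 * R"]) simp
    then have "elem_test ?\<chi>"
      using \<psi>(1) elem_smooth_affine[of \<psi> "1 / R" 0] by (simp add: elem_test_def)
    note iw = int[OF this]
    obtain \<phi> where \<phi>: "\<And>k. elem_test (\<phi> k)" "\<And>k x. cmod (\<phi> k x) \<le> indicator (box l u) x"
      "\<And>x. (\<lambda>k. \<phi> k x) \<longlonglongrightarrow> indicator (box l u) x"
      using box_bump[of l u] by metis
    have one: "?\<chi> x = 1" if "x \<in> box l u" for x
      using R(1) R(2)[OF that] by (intro \<psi>(2)) (simp add: divide_simps)
    have le: "cmod (indicator (box l u) x *\<^sub>R w x) \<le> cmod (w x * ?\<chi> x)" for x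
      using one by (auto simp: indicator_def)
    have "integrable lebesgue (\<lambda>x. indicator (box l u) x *\<^sub>R w x)"
      by (rule Bochner_Integration.integrable_bound[OF iw _ AE_I2[OF le]]) measurable
    then show si: "set_integrable lebesgue (box l u) w" by (simp add: set_integrable_def)
    have "(\<lambda>k. \<integral>x. w x * \<phi> k x \<partial>lebesgue) \<longlonglongrightarrow> (\<integral>x. w x * indicator (box l u) x \<partial>lebesgue)"
    proof (rule integral_dominated_convergence)
      show "integrable lebesgue (\<lambda>x. cmod (w x * ?\<chi> x))" using iw by (rule integrable_norm)
      show "AE x in lebesgue. cmod (w x * \<phi> k x) \<le> cmod (w x * ?\<chi> x)" for k
      proof (intro AE_I2)
        fix x
        have "cmod (w x * \<phi> k x) \<le> cmod (w x) * indicator (box l u) x"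
          unfolding norm_mult by (intro mult_left_mono \<phi>(2)) auto
        also have "\<dots> \<le> cmod (w x * ?\<chi> x)" using le[of x] by (simp add: mult.commute)
        finally show "cmod (w x * \<phi> k x) \<le> cmod (w x * ?\<chi> x)" .
      qed
      show "AE x in lebesgue. (\<lambda>k. w x * \<phi> k x) \<longlonglongrightarrow> w x * indicator (box l u) x"
        by (intro AE_I2 tendsto_mult tendsto_const \<phi>(3))
      show "(\<lambda>x. w x * \<phi> k x) \<in> borel_measurable lebesgue" for k
        using int[OF \<phi>(1)] by (rule borel_measurable_integrable)
    qed measurable
    then have "(\<lambda>k::nat. 0) \<longlonglongrightarrow> (\<integral>x. w x * indicator (box l u) x \<partial>lebesgue)"
      using zero[OF \<phi>(1)] by simp
    then have "(\<integral>x. w x * indicator (box l u) x \<partial>lebesgue) = 0"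
      by (simp add: LIMSEQ_const_iff)
    moreover have "(LINT x:box l u|lebesgue. w x) = (\<integral>x. w x * indicator (box l u) x \<partial>lebesgue)"
      unfolding set_lebesgue_integral_def
      by (intro Bochner_Integration.integral_cong) (auto simp: indicator_def)
    ultimately show "(LINT x:box l u|lebesgue. w x) = 0" by simp
  qed
  have hk: "w integrable_on cbox l u" "integral (cbox l u) w = 0" for l u
    using set_lebesgue_integral_eq_integral[OF box(1)[of l u]] box(2)[of l u]
    by (auto simp: integrable_on_open_interval integral_open_interval)
  obtain N where N: "negligible N" "\<And>x e. \<lbrakk>x \<notin> N; 0 < e\<rbrakk> \<Longrightarrow> \<exists>d>0. \<forall>h. 0 < h \<and> h < d \<longrightarrow>
      norm (integral (cbox x (x + h *\<^sub>R One)) w /\<^sub>R h ^ DIM('a) - w x) < e"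
    using integrable_ccontinuous_explicit[of w] hk(1) by metis
  \<comment> \<open>All averages over cubes are 0, so tolerance \<open>norm (w x)\<close> would give
    \<open>norm (w x) < norm (w x)\<close>.\<close>
  have "w x = 0" if "x \<notin> N" for x
  proof (rule ccontr)
    assume "w x \<noteq> 0"
    then obtain d where "d > 0" "\<forall>h. 0 < h \<and> h < d \<longrightarrow>
      norm (integral (cbox x (x + h *\<^sub>R One)) w /\<^sub>R h ^ DIM('a) - w x) < norm (w x)"
      using N(2)[OF \<open>x \<notin> N\<close>, of "norm (w x)"] by auto
    from this(2)[rule_format, of "d / 2"] \<open>d > 0\<close> show False by (simp add: hk(2))
  qed
  then show ?thesis
    using N(1) by (intro AE_I'[of N]) (auto simp: negligible_iff_null_sets)
qed

section \<open>Banach function norms of balls\<close>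

lemma bfn_eq_0_iff:
  "banach_function_norm rho \<Longrightarrow> f \<in> borel_measurable lebesgue \<Longrightarrow> rho f = 0 \<longleftrightarrow> (AE x in lebesgue. f x = 0)"
  unfolding banach_function_norm_def by blast

lemma bfn_cmult:
  "banach_function_norm rho \<Longrightarrow> f \<in> borel_measurable lebesgue \<Longrightarrow> 0 \<le> c \<Longrightarrow>
    rho (\<lambda>x. ennreal c * f x) = ennreal c * rho f"
  unfolding banach_function_norm_def by blast

lemma bfn_mono:
  "banach_function_norm rho \<Longrightarrow> f \<in> borel_measurable lebesgue \<Longrightarrow> g \<in> borel_measurable lebesgue \<Longrightarrow>
    (AE x in lebesgue. g x \<le> f x) \<Longrightarrow> rho g \<le> rho f"
  unfolding banach_function_norm_def by blast

lemma bfn_ball_finite: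
  assumes "banach_function_norm rho"
  shows "rho (indicator (ball y r)) < \<infinity>"
proof -
  have "emeasure lebesgue (ball y r) < \<infinity>"
    using emeasure_lborel_ball_finite[of y r] by simp
  then show ?thesis using assms unfolding banach_function_norm_def by simp
qed

lemma bfn_ball_pos:
  fixes y :: "'a::euclidean_space"
  assumes "banach_function_norm rho" "r > 0"
  shows "rho (indicator (ball y r)) > 0"
proof (rule ccontr)
  assume "\<not> rho (indicator (ball y r)) > 0"
  then have "AE x in lebesgue. (indicator (ball y r) x :: ennreal) = 0"
    using bfn_eq_0_iff[OF assms(1) borel_measurable_indicator, of "ball y r"] by simp
  then have "emeasure lebesgue (ball y r) = 0"
    by (subst (asm) AE_iff_measurable[OF _ refl]) (auto simp: indicator_def ball_def Collect_conj_eq)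
  moreover have "measure lebesgue (ball y r) > 0"
    using assms(2) by (simp add: content_ball_pos)
  ultimately show False by (simp add: measure_def)
qed

text \<open>Splitting the dilation factor \<open>\<tau>\<close> into \<open>k\<close> equal steps, one of the \<open>k\<close> ratios is at most the
  \<open>k\<close>-th root of the doubling constant.\<close>

lemma weak_doubling_ratio_near_1:
  fixes rho :: "('a::euclidean_space \<Rightarrow> ennreal) \<Rightarrow> ennreal"
  assumes bfn: "banach_function_norm rho" and "weak_doubling rho" and c: "c > (1::real)"
  shows "\<exists>s>1. \<forall>N. \<exists>R\<ge>N. \<exists>y. R > 0 \<and>
    rho (indicator (ball y (s * R))) \<le> ennreal c * rho (indicator (ball y R))"
proof -
  let ?n = "\<lambda>y r. rho (indicator (ball y r))"
  obtain \<tau> :: real where \<tau>: "\<tau> > 1"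
    and L: "Liminf at_top (\<lambda>R::real. INF y. ?n y (\<tau> * R) / ?n y R) < \<infinity>"
    using \<open>weak_doubling rho\<close> unfolding weak_doubling_def by blast
  obtain D' where D': "Liminf at_top (\<lambda>R::real. INF y. ?n y (\<tau> * R) / ?n y R) < D'" "D' < \<infinity>"
    using dense[OF L] by blast
  obtain d where d: "D' = ennreal d" "0 \<le> d" using D'(2) by (cases D') auto
  obtain k0 where k0: "d < c ^ k0" using real_arch_pow[OF c] by blast
  \<comment> \<open>The successor makes \<open>k\<close> positive: the \<open>k\<close>-th root is
    meaningful and the chain below has a last step.\<close>
  define k where "k = Suc k0"
  have dk: "d < c ^ k" using k0 power_strict_increasing[of k0 k c] c unfolding k_def by linarith
  define s where "s = root k \<tau>"
  have s: "s > 1" "s ^ k = \<tau>" using \<tau> real_root_pow_pos[of k \<tau>] unfolding s_def k_def by (auto simp del: power_Suc)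
  have "\<exists>R\<ge>N. \<exists>y. R > 0 \<and> ?n y (s * R) \<le> ennreal c * ?n y R" for N
  proof -
    \<comment> \<open>A lower limit below \<open>D'\<close> yields arbitrarily large radii with a
      ratio below \<open>D'\<close>; the bound 1 keeps them positive.\<close>
    have "\<exists>R\<ge>max N 1. (INF y. ?n y (\<tau> * R) / ?n y R) < D'"
    proof (rule ccontr)
      assume "\<not> ?thesis"
      then have "\<forall>\<^sub>F R in at_top. D' \<le> (INF y. ?n y (\<tau> * R) / ?n y R)"
        unfolding eventually_at_top_linorder by (intro exI[of _ "max N 1"]) (auto simp: not_less)
      from Liminf_bounded[OF this] D'(1) show False by simp
    qed
    then obtain R y where R: "R \<ge> N" "R \<ge> 1" and lt: "?n y (\<tau> * R) / ?n y R < D'"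
      unfolding INF_less_iff by auto
    have "?n y R \<noteq> 0" "?n y R \<noteq> \<infinity>"
      using bfn_ball_pos[OF bfn, of R y] bfn_ball_finite[OF bfn, of y R] R by auto
    then have "?n y (\<tau> * R) = ?n y (\<tau> * R) / ?n y R * ?n y R"
      by (simp add: ennreal_divide_times top_unique less_top ennreal_divide_self)
    also have "\<dots> \<le> D' * ?n y R" using lt by (intro mult_right_mono) auto
    also have "\<dots> \<le> ennreal (c ^ k) * ?n y R" using d dk by (intro mult_right_mono) (auto intro: ennreal_leI)
    finally have up: "?n y (\<tau> * R) \<le> ennreal (c ^ k) * ?n y R" .
    \<comment> \<open>Otherwise the \<open>k\<close> ratios, all exceeding \<open>c\<close>,
      telescope to a ratio above \<open>c ^ k\<close> between radii \<open>\<tau> * R\<close> and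
      \<open>R\<close>, contradicting \<open>up\<close>.\<close>
    have "\<exists>i<k. ?n y (s * (s ^ i * R)) \<le> ennreal c * ?n y (s ^ i * R)"
    proof (rule ccontr)
      assume "\<not> ?thesis"
      then have step: "ennreal c * ?n y (s ^ i * R) < ?n y (s ^ Suc i * R)" if "i < k" for i
        using that by (auto simp: not_le mult_ac)
      have chain: "ennreal (c ^ i) * ?n y R \<le> ?n y (s ^ i * R)" if "i \<le> k" for i
        using that
      proof (induction i)
        case (Suc i)
        then have "ennreal c * (ennreal (c ^ i) * ?n y R) \<le> ennreal c * ?n y (s ^ i * R)"
          by (intro mult_left_mono) auto
        also have "\<dots> \<le> ?n y (s ^ Suc i * R)" using step[of i] Suc.prems by simp
        finally show ?case using c by (simp add: ennreal_mult mult.assoc)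
      qed simp
      \<comment> \<open>Strictness is taken from the last step alone, so the induction can remain
        non-strict in \<open>ennreal\<close>.\<close>
      have "ennreal (c ^ k) * ?n y R = ennreal c * (ennreal (c ^ k0) * ?n y R)"
        using c by (simp add: k_def ennreal_mult mult.assoc)
      also have "\<dots> \<le> ennreal c * ?n y (s ^ k0 * R)"
        using chain[of k0] by (intro mult_left_mono) (auto simp: k_def)
      also have "\<dots> < ?n y (s ^ k * R)" using step[of k0] by (simp add: k_def)
      finally show False using up s(2) by simp
    qed
    then obtain i where i: "?n y (s * (s ^ i * R)) \<le> ennreal c * ?n y (s ^ i * R)" by blast
    \<comment> \<open>The radius found is \<open>s ^ i * R\<close>, which is no smaller than
      \<open>R\<close>, so it is still as large as demanded.\<close>
    have "1 \<le> s ^ i" using s(1) by (intro one_le_power) simp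
    then have "R \<le> s ^ i * R" using R(2) mult_right_mono[of 1 "s ^ i" R] by simp
    with R have "N \<le> s ^ i * R" "0 < s ^ i * R" by linarith+
    with i show ?thesis by blast
  qed
  with s(1) show ?thesis by blast
qed

text \<open>Clearing the denominator in \<open>ennreal\<close> requires the norm of \<open>u\<close>
  to be neither 0, by (A1), nor infinite.\<close>

lemma distr_Xnorm_le_multiplier_norm:
  assumes "banach_function_norm rho" "schwartz u" "in_X rho u" "\<not> (AE x in lebesgue. u x = 0)"
  shows "distr_Xnorm rho (mult_op_distr a u) \<le> multiplier_norm rho a * Xnorm rho u"
proof -
  let ?d = "distr_Xnorm rho (mult_op_distr a u)"
  have m: "u \<in> borel_measurable lebesgue" and fin: "Xnorm rho u \<noteq> \<infinity>"
    using assms(3) by (auto simp: in_X_def)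
  have "Xnorm rho u \<noteq> 0"
    using bfn_eq_0_iff[OF assms(1), of "\<lambda>x. ennreal (cmod (u x))"] m assms(4)
    by (simp add: Xnorm_def)
  then have "?d = ?d / Xnorm rho u * Xnorm rho u"
    using fin by (simp add: ennreal_divide_times top_unique less_top ennreal_divide_self)
  also have "\<dots> \<le> multiplier_norm rho a * Xnorm rho u"
    unfolding multiplier_norm_def using assms by (intro mult_right_mono SUP_upper) auto
  finally show ?thesis .
qed

section \<open>Multipliers applied to modulated cutoffs\<close>

text \<open>The argument of \<open>\<psi>\<close> has the form \<open>c *\<^sub>R x + v\<close>, so
  that \<open>elem_smooth_affine\<close> applies directly.\<close>

definition bump_at :: "('a::euclidean_space \<Rightarrow> complex) \<Rightarrow> real \<Rightarrow> 'a \<Rightarrow> 'a \<Rightarrow> 'a \<Rightarrow> complex" where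
  "bump_at \<psi> R y \<eta> x = \<psi> ((1 / R) *\<^sub>R x + - (1 / R) *\<^sub>R y) * cis (x \<bullet> \<eta>)"

lemma bump_at_eqs:
  assumes "R > 0"
  shows "\<psi> ((1 / R) *\<^sub>R x + - (1 / R) *\<^sub>R y) = \<psi> ((1 / R) *\<^sub>R (x - y))"
    "norm ((1 / R) *\<^sub>R (x - y)) = dist y x / R"
    "cmod (bump_at \<psi> R y \<eta> x) = cmod (\<psi> ((1 / R) *\<^sub>R (x - y)))"
proof -
  show eq: "\<psi> ((1 / R) *\<^sub>R x + - (1 / R) *\<^sub>R y) = \<psi> ((1 / R) *\<^sub>R (x - y))"
    by (simp add: algebra_simps)
  show "norm ((1 / R) *\<^sub>R (x - y)) = dist y x / R"
    using assms unfolding norm_scaleR by (simp add: dist_norm norm_minus_commute)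
  show "cmod (bump_at \<psi> R y \<eta> x) = cmod (\<psi> ((1 / R) *\<^sub>R (x - y)))"
    unfolding bump_at_def eq by (simp add: norm_mult)
qed

lemma bump_at_elem_test:
  assumes "elem_test \<psi>" "R > 0"
  shows "elem_test (bump_at \<psi> R y \<eta>)"
proof -
  obtain r where r: "\<And>x. \<psi> x \<noteq> 0 \<Longrightarrow> norm x \<le> r" using elem_test_bounded_support[OF assms(1)] by metis
  have "norm x \<le> norm y + r * R" if "bump_at \<psi> R y \<eta> x \<noteq> 0" for x
  proof -
    have "\<psi> ((1 / R) *\<^sub>R (x - y)) \<noteq> 0"
      using that unfolding bump_at_def bump_at_eqs(1)[OF assms(2)] by auto
    from r[OF this] have "dist y x \<le> r * R" using assms(2)
      unfolding bump_at_eqs(2)[OF assms(2)] by (simp add: pos_divide_le_eq)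
    then show ?thesis using norm_triangle_ineq2[of x y] by (simp add: dist_norm norm_minus_commute)
  qed
  then have "bounded {x. bump_at \<psi> R y \<eta> x \<noteq> 0}"
    by (intro boundedI[where B="norm y + r * R"]) simp
  moreover have "elem_smooth (bump_at \<psi> R y \<eta>)"
    unfolding bump_at_def using assms(1)
    by (intro elem_smooth.mult elem_smooth_affine elem_smooth_cis) (simp add: elem_test_def)
  ultimately show ?thesis by (simp add: elem_test_def)
qed

text \<open>Translation by \<open>y\<close> contributes only a phase, which the modulus removes.
  This is the source of the uniformity in \<open>y\<close>.\<close>

lemma bump_at_fourier:
  fixes \<psi> :: "'a::euclidean_space \<Rightarrow> complex"
  assumes \<psi>: "elem_test \<psi>" and R: "R > 0"
  shows "cmod (fourier (bump_at \<psi> R y \<eta>) \<xi>) = R ^ DIM('a) * cmod (fourier \<psi> (R *\<^sub>R (\<xi> - \<eta>)))"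
proof -
  note [measurable] = elem_test_measurable[OF \<psi>] elem_test_measurable[OF bump_at_elem_test[OF \<psi> R]]
  have "fourier (bump_at \<psi> R y \<eta>) \<xi> = (\<integral>x. bump_at \<psi> R y \<eta> x * cis (- (x \<bullet> \<xi>)) \<partial>lborel)"
    by (rule fourier_lborel[OF bump_at_elem_test[OF \<psi> R]])
  also have "\<dots> = complex_of_real (R ^ DIM('a)) *
      (\<integral>z. bump_at \<psi> R y \<eta> (y + R *\<^sub>R z) * cis (- ((y + R *\<^sub>R z) \<bullet> \<xi>)) \<partial>lborel)"
    by (rule lborel_integral_affine[OF _ R]) measurable
  also have "(\<integral>z. bump_at \<psi> R y \<eta> (y + R *\<^sub>R z) * cis (- ((y + R *\<^sub>R z) \<bullet> \<xi>)) \<partial>lborel) =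
      (\<integral>z. cis (y \<bullet> (\<eta> - \<xi>)) * (\<psi> z * cis (- (z \<bullet> (R *\<^sub>R (\<xi> - \<eta>))))) \<partial>lborel)"
  proof (intro Bochner_Integration.integral_cong refl)
    fix z
    have "bump_at \<psi> R y \<eta> (y + R *\<^sub>R z) = \<psi> z * cis ((y + R *\<^sub>R z) \<bullet> \<eta>)"
      using R by (simp add: bump_at_def scaleR_add_right)
    moreover have "cis ((y + R *\<^sub>R z) \<bullet> \<eta>) * cis (- ((y + R *\<^sub>R z) \<bullet> \<xi>)) =
        cis (y \<bullet> (\<eta> - \<xi>)) * cis (- (z \<bullet> (R *\<^sub>R (\<xi> - \<eta>))))"
      by (simp add: cis_mult inner_add_left inner_diff_right algebra_simps)
    ultimately show "bump_at \<psi> R y \<eta> (y + R *\<^sub>R z) * cis (- ((y + R *\<^sub>R z) \<bullet> \<xi>)) =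
        cis (y \<bullet> (\<eta> - \<xi>)) * (\<psi> z * cis (- (z \<bullet> (R *\<^sub>R (\<xi> - \<eta>)))))"
      by (simp add: mult_ac)
  qed
  also have "\<dots> = cis (y \<bullet> (\<eta> - \<xi>)) * fourier \<psi> (R *\<^sub>R (\<xi> - \<eta>))"
    unfolding fourier_lborel[OF \<psi>] by (rule integral_mult_right_zero)
  finally show ?thesis using R by (simp add: norm_mult norm_power)
qed

text \<open>The integral form of F^-1 a F u, taken over \<open>lborel\<close> because it is applied
  to a Borel version of the symbol.\<close>

definition mult_op :: "('a::euclidean_space \<Rightarrow> complex) \<Rightarrow> ('a \<Rightarrow> complex) \<Rightarrow> 'a \<Rightarrow> complex" where
  "mult_op a u x = complex_of_real ((2 * pi) powr (- real DIM('a))) *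
     (\<integral>\<xi>. a \<xi> * fourier u \<xi> * cis (x \<bullet> \<xi>) \<partial>lborel)"

text \<open>Decay of \<open>fourier u\<close> of a natural order at least \<open>\<sigma>\<close>
  compensates for the weight.\<close>

lemma integrable_weighted_mult_fourier:
  fixes a :: "'a::euclidean_space \<Rightarrow> complex"
  assumes [measurable]: "a \<in> borel_measurable borel"
    and a: "(\<integral>\<^sup>+\<xi>. ennreal ((1 + norm \<xi>) powr (- \<sigma>) * cmod (a \<xi>)) \<partial>lborel) < \<infinity>"
    and u: "elem_test u"
  shows "integrable lborel (\<lambda>\<xi>. a \<xi> * fourier u \<xi>)"
proof -
  note [measurable] = fourier_measurable[OF u]
  obtain N :: nat where N: "\<sigma> \<le> real N" using real_arch_simple by blast
  obtain C where C: "\<And>\<xi>. (1 + norm \<xi>) ^ N * cmod (fourier u \<xi>) \<le> C" using fourier_decay[OF u] by blast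
  let ?w = "\<lambda>\<xi>. (1 + norm \<xi>) powr (- \<sigma>) * cmod (a \<xi>)"
  show ?thesis
  proof (rule Bochner_Integration.integrable_bound)
    show "integrable lborel (\<lambda>\<xi>. C * ?w \<xi>)"
      using a by (intro integrable_mult_right integrableI_bounded) auto
    show "AE \<xi> in lborel. cmod (a \<xi> * fourier u \<xi>) \<le> norm (C * ?w \<xi>)"
    proof (intro AE_I2)
      fix \<xi>
      have "cmod (a \<xi> * fourier u \<xi>) \<le> ((1 + norm \<xi>) ^ N * ?w \<xi>) * cmod (fourier u \<xi>)"
        unfolding norm_mult using weight_le[OF N order_refl, of "cmod (a \<xi>)" \<xi>]
        by (intro mult_right_mono) auto
      also have "\<dots> = ((1 + norm \<xi>) ^ N * cmod (fourier u \<xi>)) * ?w \<xi>" by (simp only: mult_ac)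
      also have "\<dots> \<le> C * ?w \<xi>" by (intro mult_right_mono C) auto
      finally show "cmod (a \<xi> * fourier u \<xi>) \<le> norm (C * ?w \<xi>)" by simp
    qed
  qed measurable
qed

lemma mult_op_bounded_measurable:
  fixes a :: "'a::euclidean_space \<Rightarrow> complex"
  assumes int: "integrable lborel (\<lambda>\<xi>. a \<xi> * fourier u \<xi>)"
  shows "mult_op a u \<in> borel_measurable borel" "\<exists>B. \<forall>x. cmod (mult_op a u x) \<le> B"
proof -
  note [measurable] = borel_measurable_integrable[OF int]
  show "mult_op a u \<in> borel_measurable borel" unfolding mult_op_def by measurable
  have "cmod (\<integral>\<xi>. a \<xi> * fourier u \<xi> * cis (x \<bullet> \<xi>) \<partial>lborel) \<le> (\<integral>\<xi>. cmod (a \<xi> * fourier u \<xi>) \<partial>lborel)" for x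
    using integral_norm_bound[of lborel "\<lambda>\<xi>. a \<xi> * fourier u \<xi> * cis (x \<bullet> \<xi>)"] by (simp add: norm_mult)
  then have "cmod (mult_op a u x) \<le> (2 * pi) powr (- real DIM('a)) * (\<integral>\<xi>. cmod (a \<xi> * fourier u \<xi>) \<partial>lborel)" for x
    unfolding mult_op_def norm_mult norm_of_real by (simp add: mult_left_mono)
  then show "\<exists>B. \<forall>x. cmod (mult_op a u x) \<le> B" by blast
qed

text \<open>Fubini moves the inverse transform from \<open>\<phi>\<close> to the symbol times
  \<open>fourier u\<close>; the kernel \<open>cis (x \<bullet> \<xi>)\<close> is symmetric in its
  two variables.\<close>

lemma mult_op_distr_eq:
  fixes a a' :: "'a::euclidean_space \<Rightarrow> complex"
  assumes a[measurable]: "a \<in> borel_measurable lebesgue" and a'[measurable]: "a' \<in> borel_measurable borel"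
    and ae: "AE \<xi> in lebesgue. a \<xi> = a' \<xi>"
    and int: "integrable lborel (\<lambda>\<xi>. a' \<xi> * fourier u \<xi>)"
    and u: "elem_test u" and \<phi>: "elem_test \<phi>"
  shows "mult_op_distr a u \<phi> = (\<integral>x. mult_op a' u x * \<phi> x \<partial>lborel)"
proof -
  let ?\<kappa> = "complex_of_real ((2 * pi) powr (- real DIM('a)))"
  note [measurable] = elem_test_measurable[OF \<phi>] fourier_measurable[OF u]
  have inv: "inv_fourier \<phi> \<xi> = ?\<kappa> * (\<integral>x. \<phi> x * cis (x \<bullet> \<xi>) \<partial>lborel)" for \<xi>
  proof -
    have "(\<lambda>x. \<phi> x * cis (\<xi> \<bullet> x)) \<in> borel_measurable lborel" by measurable
    then show ?thesis unfolding inv_fourier_def by (simp add: integral_completion inner_commute)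
  qed
  have m[measurable]: "inv_fourier \<phi> \<in> borel_measurable borel" unfolding inv by measurable
  have meas: "(\<lambda>\<xi>. a' \<xi> * fourier u \<xi> * inv_fourier \<phi> \<xi>) \<in> borel_measurable lborel" by measurable
  have [measurable]: "fourier u \<in> borel_measurable lebesgue" "inv_fourier \<phi> \<in> borel_measurable lebesgue"
    "a' \<in> borel_measurable lebesgue"
    using m a' fourier_measurable[OF u] by (auto intro: measurable_completion)
  have "mult_op_distr a u \<phi> = (\<integral>\<xi>. a' \<xi> * fourier u \<xi> * inv_fourier \<phi> \<xi> \<partial>lebesgue)"
    unfolding mult_op_distr_def using ae by (intro integral_cong_AE) auto
  also have "\<dots> = (\<integral>\<xi>. a' \<xi> * fourier u \<xi> * inv_fourier \<phi> \<xi> \<partial>lborel)"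
    by (rule integral_completion[OF meas])
  also have "\<dots> = (\<integral>\<xi>. (\<integral>x. ?\<kappa> * (a' \<xi> * fourier u \<xi> * cis (x \<bullet> \<xi>)) * \<phi> x \<partial>lborel) \<partial>lborel)"
  proof (intro Bochner_Integration.integral_cong refl)
    fix \<xi>
    have "a' \<xi> * fourier u \<xi> * inv_fourier \<phi> \<xi> = (\<integral>x. (a' \<xi> * fourier u \<xi> * ?\<kappa>) * (\<phi> x * cis (x \<bullet> \<xi>)) \<partial>lborel)"
      unfolding inv integral_mult_right_zero by (simp only: mult_ac)
    then show "a' \<xi> * fourier u \<xi> * inv_fourier \<phi> \<xi> = (\<integral>x. ?\<kappa> * (a' \<xi> * fourier u \<xi> * cis (x \<bullet> \<xi>)) * \<phi> x \<partial>lborel)"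
      by (simp only: mult_ac)
  qed
  also have "\<dots> = (\<integral>x. (\<integral>\<xi>. ?\<kappa> * (a' \<xi> * fourier u \<xi> * cis (x \<bullet> \<xi>)) * \<phi> x \<partial>lborel) \<partial>lborel)"
  proof (rule lborel_Fubini_dominated)
    show "integrable lborel (\<lambda>\<xi>. (2 * pi) powr (- real DIM('a)) * cmod (a' \<xi> * fourier u \<xi>))"
      by (intro integrable_mult_right integrable_norm int)
    show "integrable lborel (\<lambda>x. cmod (\<phi> x))" by (intro integrable_norm elem_test_integrable \<phi>)
  qed (measurable, simp add: norm_mult)
  also have "\<dots> = (\<integral>x. mult_op a' u x * \<phi> x \<partial>lborel)"
    unfolding mult_op_def integral_mult_left_zero integral_mult_right_zero ..
  finally show ?thesis .
qed

text \<open>The infimum in \<open>distr_Xnorm\<close> ranges over all representatives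
  \<open>g\<close>. Their difference from the bounded function \<open>mult_op a' u\<close> is
  orthogonal to all \<open>elem_test\<close> functions, hence vanishes almost everywhere.\<close>

lemma represents_AE_eq:
  fixes a a' :: "'a::euclidean_space \<Rightarrow> complex"
  assumes a: "a \<in> borel_measurable lebesgue" and a': "a' \<in> borel_measurable borel"
    and ae: "AE \<xi> in lebesgue. a \<xi> = a' \<xi>"
    and int: "integrable lborel (\<lambda>\<xi>. a' \<xi> * fourier u \<xi>)"
    and u: "elem_test u" and g: "represents g (mult_op_distr a u)"
  shows "AE x in lebesgue. g x = mult_op a' u x"
proof -
  note h = mult_op_bounded_measurable[OF int]
  obtain B where B: "\<And>x. cmod (mult_op a' u x) \<le> B" using h(2) by blast
  have [measurable]: "mult_op a' u \<in> borel_measurable lebesgue" using h(1) by (auto intro: measurable_completion)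
  have [measurable]: "g \<in> borel_measurable lebesgue" using g by (simp add: represents_def)
  have "integrable lebesgue (\<lambda>x. (g x - mult_op a' u x) * \<phi> x) \<and>
      (\<integral>x. (g x - mult_op a' u x) * \<phi> x \<partial>lebesgue) = 0" if \<phi>: "elem_test \<phi>" for \<phi>
  proof -
    have g\<phi>: "integrable lebesgue (\<lambda>x. g x * \<phi> x)" "(\<integral>x. g x * \<phi> x \<partial>lebesgue) = mult_op_distr a u \<phi>"
      using g elem_test_imp_test_function[OF \<phi>] by (auto simp: represents_def)
    note [measurable] = elem_test_measurable[OF \<phi>] h(1)
    have m: "(\<lambda>x. mult_op a' u x * \<phi> x) \<in> borel_measurable lborel" by measurable
    have "integrable lborel (\<lambda>x. mult_op a' u x * \<phi> x)"
    proof (rule Bochner_Integration.integrable_bound[OF integrable_mult_right[OF elem_test_integrable[OF \<phi>], of "of_real B"] m])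
      show "AE x in lborel. cmod (mult_op a' u x * \<phi> x) \<le> cmod (of_real B * \<phi> x)"
        unfolding norm_mult norm_of_real
        by (intro AE_I2 mult_right_mono order_trans[OF B abs_ge_self]) auto
    qed
    then have h\<phi>: "integrable lebesgue (\<lambda>x. mult_op a' u x * \<phi> x)"
      using integrable_completion[OF m] by simp
    have "(\<integral>x. mult_op a' u x * \<phi> x \<partial>lebesgue) = mult_op_distr a u \<phi>"
      unfolding mult_op_distr_eq[OF a a' ae int u \<phi>] by (rule integral_completion[OF m])
    then show ?thesis
      using g\<phi> h\<phi> by (simp add: left_diff_distrib)
  qed
  then have "AE x in lebesgue. g x - mult_op a' u x = 0"
    by (intro AE_eq_0_if_orthogonal_to_tests) auto
  then show ?thesis by simp
qed

text \<open>Fourier inversion writes \<open>a \<eta> * u x\<close> as the same integral with the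
  constant symbol \<open>a \<eta>\<close>. In the difference the modulus removes the character in
  \<open>x\<close>, so the bound depends on neither \<open>x\<close> nor \<open>y\<close>.\<close>

lemma mult_op_minus_const_le:
  fixes a :: "'a::euclidean_space \<Rightarrow> complex"
  assumes [measurable]: "a \<in> borel_measurable borel"
    and int: "integrable lborel (\<lambda>\<xi>. a \<xi> * fourier (bump_at \<psi> R y \<eta>) \<xi>)"
    and \<psi>: "elem_test \<psi>" and R: "R > 0"
  shows "ennreal (cmod (mult_op a (bump_at \<psi> R y \<eta>) x - a \<eta> * bump_at \<psi> R y \<eta> x)) \<le>
    ennreal ((2 * pi) powr (- real DIM('a))) *
      (\<integral>\<^sup>+\<zeta>. ennreal (cmod (a ((1 / R) *\<^sub>R \<zeta> + \<eta>) - a \<eta>) * cmod (fourier \<psi> \<zeta>)) \<partial>lborel)"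
proof -
  let ?u = "bump_at \<psi> R y \<eta>" and ?\<kappa> = "(2 * pi) powr (- real DIM('a))"
  have u: "elem_test ?u" by (rule bump_at_elem_test[OF \<psi> R])
  note [measurable] = fourier_measurable[OF u] fourier_measurable[OF \<psi>]
  have intu: "integrable lborel (fourier ?u)"
    using fourier_integrable[OF u, of 0] by (simp add: integrable_norm_iff fourier_measurable[OF u])
  have int_cis: "integrable lborel (\<lambda>\<xi>. f \<xi> * cis (x \<bullet> \<xi>))" if f: "integrable lborel f" for f :: "'a \<Rightarrow> complex"
  proof (rule Bochner_Integration.integrable_bound[OF f])
    note [measurable] = borel_measurable_integrable[OF f]
    show "(\<lambda>\<xi>. f \<xi> * cis (x \<bullet> \<xi>)) \<in> borel_measurable lborel" by measurable
  qed (simp add: norm_mult)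
  have "?\<kappa> * (2 * pi) ^ DIM('a) = 1"
    by (subst powr_minus, subst powr_realpow, simp, rule left_inverse) simp
  then have "?u x = complex_of_real (?\<kappa> * (2 * pi) ^ DIM('a)) * ?u x" by simp
  also have "\<dots> = complex_of_real ?\<kappa> * (\<integral>\<xi>. fourier ?u \<xi> * cis (x \<bullet> \<xi>) \<partial>lborel)"
    unfolding fourier_inversion[OF u] of_real_mult by (simp only: mult.assoc)
  finally have ux: "?u x = complex_of_real ?\<kappa> * (\<integral>\<xi>. fourier ?u \<xi> * cis (x \<bullet> \<xi>) \<partial>lborel)" .
  have "mult_op a ?u x - a \<eta> * ?u x = complex_of_real ?\<kappa> *
      ((\<integral>\<xi>. a \<xi> * fourier ?u \<xi> * cis (x \<bullet> \<xi>) \<partial>lborel) - (\<integral>\<xi>. a \<eta> * (fourier ?u \<xi> * cis (x \<bullet> \<xi>)) \<partial>lborel))"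
    unfolding mult_op_def ux integral_mult_right_zero by (simp add: algebra_simps)
  also have "(\<integral>\<xi>. a \<xi> * fourier ?u \<xi> * cis (x \<bullet> \<xi>) \<partial>lborel) - (\<integral>\<xi>. a \<eta> * (fourier ?u \<xi> * cis (x \<bullet> \<xi>)) \<partial>lborel) =
      (\<integral>\<xi>. a \<xi> * fourier ?u \<xi> * cis (x \<bullet> \<xi>) - a \<eta> * (fourier ?u \<xi> * cis (x \<bullet> \<xi>)) \<partial>lborel)"
    by (intro Bochner_Integration.integral_diff[symmetric] int_cis int integrable_mult_right intu)
  finally have eq: "mult_op a ?u x - a \<eta> * ?u x = complex_of_real ?\<kappa> *
      (\<integral>\<xi>. a \<xi> * fourier ?u \<xi> * cis (x \<bullet> \<xi>) - a \<eta> * (fourier ?u \<xi> * cis (x \<bullet> \<xi>)) \<partial>lborel)" .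
  have "ennreal (cmod (mult_op a ?u x - a \<eta> * ?u x)) = ennreal ?\<kappa> *
      ennreal (cmod (\<integral>\<xi>. a \<xi> * fourier ?u \<xi> * cis (x \<bullet> \<xi>) - a \<eta> * (fourier ?u \<xi> * cis (x \<bullet> \<xi>)) \<partial>lborel))"
    unfolding eq norm_mult norm_of_real by (simp add: ennreal_mult)
  also have "\<dots> \<le> ennreal ?\<kappa> *
      (\<integral>\<^sup>+\<xi>. ennreal (cmod (a \<xi> * fourier ?u \<xi> * cis (x \<bullet> \<xi>) - a \<eta> * (fourier ?u \<xi> * cis (x \<bullet> \<xi>)))) \<partial>lborel)"
    by (intro mult_left_mono integral_norm_bound_ennreal Bochner_Integration.integrable_diff
        int_cis int integrable_mult_right intu) auto
  also have "(\<integral>\<^sup>+\<xi>. ennreal (cmod (a \<xi> * fourier ?u \<xi> * cis (x \<bullet> \<xi>) - a \<eta> * (fourier ?u \<xi> * cis (x \<bullet> \<xi>)))) \<partial>lborel) =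
      (\<integral>\<^sup>+\<xi>. ennreal (cmod (a \<xi> - a \<eta>) * (R ^ DIM('a) * cmod (fourier \<psi> (R *\<^sub>R (\<xi> - \<eta>))))) \<partial>lborel)"
  proof (intro nn_integral_cong arg_cong[where f=ennreal])
    fix \<xi>
    have "a \<xi> * fourier ?u \<xi> * cis (x \<bullet> \<xi>) - a \<eta> * (fourier ?u \<xi> * cis (x \<bullet> \<xi>)) =
        (a \<xi> - a \<eta>) * fourier ?u \<xi> * cis (x \<bullet> \<xi>)" by (simp add: algebra_simps)
    then show "cmod (a \<xi> * fourier ?u \<xi> * cis (x \<bullet> \<xi>) - a \<eta> * (fourier ?u \<xi> * cis (x \<bullet> \<xi>))) =
        cmod (a \<xi> - a \<eta>) * (R ^ DIM('a) * cmod (fourier \<psi> (R *\<^sub>R (\<xi> - \<eta>))))"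
      by (simp add: norm_mult bump_at_fourier[OF \<psi> R])
  qed
  \<comment> \<open>Substituting \<open>\<xi> = \<eta> + (1 / R) *\<^sub>R \<zeta>\<close> gives a
    Jacobian that cancels the factor \<open>R ^ DIM('a)\<close> of
    \<open>bump_at_fourier\<close>.\<close>
  also have "\<dots> = ennreal ((1 / R) ^ DIM('a)) * (\<integral>\<^sup>+\<zeta>. ennreal (cmod (a (\<eta> + (1 / R) *\<^sub>R \<zeta>) - a \<eta>) *
      (R ^ DIM('a) * cmod (fourier \<psi> (R *\<^sub>R (\<eta> + (1 / R) *\<^sub>R \<zeta> - \<eta>))))) \<partial>lborel)"
    using R by (intro lborel_nn_integral_affine) auto
  also have "\<dots> = (\<integral>\<^sup>+\<zeta>. ennreal ((1 / R) ^ DIM('a)) * ennreal (cmod (a (\<eta> + (1 / R) *\<^sub>R \<zeta>) - a \<eta>) *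
      (R ^ DIM('a) * cmod (fourier \<psi> (R *\<^sub>R (\<eta> + (1 / R) *\<^sub>R \<zeta> - \<eta>))))) \<partial>lborel)"
    by (rule nn_integral_cmult[symmetric]) measurable
  also have "\<dots> = (\<integral>\<^sup>+\<zeta>. ennreal (cmod (a ((1 / R) *\<^sub>R \<zeta> + \<eta>) - a \<eta>) * cmod (fourier \<psi> \<zeta>)) \<partial>lborel)"
    using R by (intro nn_integral_cong) (simp add: add.commute power_divide field_simps flip: ennreal_mult)
  finally show ?thesis .
qed

text \<open>The bump has modulus 1 on the inner ball, so every representative has modulus at least
  \<open>cmod (a' \<eta>) - \<delta>\<close> almost everywhere there; it is dominated by the
  indicator of the outer ball, which bounds its own norm.\<close>

lemma multiplier_pointwise_bound:
  fixes a a' :: "'a::euclidean_space \<Rightarrow> complex" and \<psi> :: "'a \<Rightarrow> complex"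
  assumes bfn: "banach_function_norm rho"
    and a: "a \<in> borel_measurable lebesgue" and a': "a' \<in> borel_measurable borel"
    and ae: "AE \<xi> in lebesgue. a \<xi> = a' \<xi>"
    and w: "(\<integral>\<^sup>+\<xi>. ennreal ((1 + norm \<xi>) powr (- \<sigma>) * cmod (a' \<xi>)) \<partial>lborel) < \<infinity>"
    and \<psi>: "elem_test \<psi>" "\<And>x. norm x \<le> 1 \<Longrightarrow> \<psi> x = 1" "\<And>x. norm x \<ge> s \<Longrightarrow> \<psi> x = 0"
      "\<And>x. cmod (\<psi> x) \<le> 1"
    and R: "R > 0"
    and \<delta>: "ennreal ((2 * pi) powr (- real DIM('a))) *
      (\<integral>\<^sup>+\<zeta>. ennreal (cmod (a' ((1 / R) *\<^sub>R \<zeta> + \<eta>) - a' \<eta>) * cmod (fourier \<psi> \<zeta>)) \<partial>lborel) \<le> ennreal \<delta>"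
      "\<delta> \<ge> 0"
  shows "ennreal (cmod (a' \<eta>) - \<delta>) * rho (indicator (ball y R)) \<le>
    multiplier_norm rho a * rho (indicator (ball y (s * R)))"
proof (cases "cmod (a' \<eta>) - \<delta> \<ge> 0")
  \<comment> \<open>In the other case \<open>ennreal\<close> sends the negative difference to 0 and
    the claim is trivial.\<close>
  case nonneg: True
  let ?u = "bump_at \<psi> R y \<eta>"
  have u: "elem_test ?u" by (rule bump_at_elem_test[OF \<psi>(1) R])
  have [measurable]: "?u \<in> borel_measurable lebesgue"
    using elem_test_measurable[OF u] by (auto intro: measurable_completion)
  have int: "integrable lborel (\<lambda>\<xi>. a' \<xi> * fourier ?u \<xi>)"
    by (rule integrable_weighted_mult_fourier[OF a' w u])
  have u1: "cmod (?u x) = 1" if "x \<in> ball y R" for x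
  proof -
    have "norm ((1 / R) *\<^sub>R (x - y)) \<le> 1" unfolding bump_at_eqs(2)[OF R] using that R by simp
    then show ?thesis unfolding bump_at_eqs(3)[OF R] by (simp only: \<psi>(2) norm_one)
  qed
  have u_le: "ennreal (cmod (?u x)) \<le> indicator (ball y (s * R)) x" for x
  proof (cases "x \<in> ball y (s * R)")
    case True
    then show ?thesis unfolding bump_at_eqs(3)[OF R] using \<psi>(4) by (simp add: ennreal_le_1)
  next
    case False
    then have "norm ((1 / R) *\<^sub>R (x - y)) \<ge> s"
      unfolding bump_at_eqs(2)[OF R] using R by (simp add: pos_le_divide_eq)
    then show ?thesis unfolding bump_at_eqs(3)[OF R] by (simp only: \<psi>(3) norm_zero) simp
  qed
  have Xu: "Xnorm rho ?u \<le> rho (indicator (ball y (s * R)))"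
    unfolding Xnorm_def by (rule bfn_mono[OF bfn]) (auto simp: u_le intro: borel_measurable_indicator)
  have "in_X rho ?u"
    using Xu bfn_ball_finite[OF bfn, of y "s * R"] by (auto simp: in_X_def intro: order.strict_trans1)
  moreover have "schwartz ?u" using elem_test_imp_test_function[OF u] by (simp add: test_function_def)
  moreover have "\<not> (AE x in lebesgue. ?u x = 0)"
  proof
    assume "AE x in lebesgue. ?u x = 0"
    then have "AE x in lebesgue. (indicator (ball y R) x :: ennreal) = 0"
      by eventually_elim (use u1 in \<open>fastforce simp: indicator_def\<close>)
    then have "rho (indicator (ball y R)) = 0"
      using bfn_eq_0_iff[OF bfn borel_measurable_indicator, of "ball y R"] by simp
    with bfn_ball_pos[OF bfn R, of y] show False by simp
  qed
  ultimately have mult: "distr_Xnorm rho (mult_op_distr a ?u) \<le> multiplier_norm rho a * Xnorm rho ?u"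
    by (intro distr_Xnorm_le_multiplier_norm bfn)
  have "ennreal (cmod (a' \<eta>) - \<delta>) * rho (indicator (ball y R)) \<le> distr_Xnorm rho (mult_op_distr a ?u)"
    unfolding distr_Xnorm_def
  proof (rule INF_greatest)
    fix g assume "g \<in> {g. represents g (mult_op_distr a ?u)}"
    then have g: "represents g (mult_op_distr a ?u)" by simp
    have [measurable]: "g \<in> borel_measurable lebesgue" using g by (simp add: represents_def)
    have "AE x in lebesgue. ennreal (cmod (a' \<eta>) - \<delta>) * indicator (ball y R) x \<le> ennreal (cmod (g x))"
      using represents_AE_eq[OF a a' ae int u g]
    proof eventually_elim
      case (elim x)
      show ?case
      proof (cases "x \<in> ball y R")
        case True
        have "cmod (g x - a' \<eta> * ?u x) \<le> \<delta>"
          using order_trans[OF mult_op_minus_const_le[OF a' int \<psi>(1) R, of x] \<delta>(1)] \<delta>(2) elim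
          by (simp add: ennreal_le_iff)
        moreover have "cmod (a' \<eta> * ?u x) = cmod (a' \<eta>)" using u1[OF True] by (simp add: norm_mult)
        moreover have "cmod (a' \<eta> * ?u x) \<le> cmod (g x) + cmod (g x - a' \<eta> * ?u x)"
          using norm_triangle_ineq4[of "g x" "g x - a' \<eta> * ?u x"] by simp
        ultimately show ?thesis using True by (simp add: ennreal_leI)
      qed simp
    qed
    then have "rho (\<lambda>x. ennreal (cmod (a' \<eta>) - \<delta>) * indicator (ball y R) x) \<le> Xnorm rho g"
      unfolding Xnorm_def
      by (intro bfn_mono[OF bfn]) (auto intro!: borel_measurable_times_ennreal borel_measurable_indicator)
    then show "ennreal (cmod (a' \<eta>) - \<delta>) * rho (indicator (ball y R)) \<le> Xnorm rho g"
      using nonneg by (subst (asm) bfn_cmult[OF bfn]) (auto intro: borel_measurable_indicator)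
  qed
  also note mult
  also have "multiplier_norm rho a * Xnorm rho ?u \<le> multiplier_norm rho a * rho (indicator (ball y (s * R)))"
    using Xu by (rule mult_left_mono) simp
  finally show ?thesis .
qed (simp add: ennreal_neg)

lemma AE_le_multiplier_norm_times:
  fixes a a' :: "'a::euclidean_space \<Rightarrow> complex"
  assumes bfn: "banach_function_norm rho" and wd: "weak_doubling rho"
    and a: "a \<in> borel_measurable lebesgue" and a': "a' \<in> borel_measurable borel"
    and ae: "AE \<xi> in lebesgue. a \<xi> = a' \<xi>"
    and w: "(\<integral>\<^sup>+\<xi>. ennreal ((1 + norm \<xi>) powr (- \<sigma>) * cmod (a' \<xi>)) \<partial>lborel) < \<infinity>"
    and c: "c > 1"
  shows "AE \<eta> in lborel. ennreal (cmod (a' \<eta>)) \<le> ennreal c * multiplier_norm rho a"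
proof -
  obtain s where s: "s > 1" "\<And>N. \<exists>R\<ge>N. \<exists>y. R > 0 \<and>
      rho (indicator (ball y (s * R))) \<le> ennreal c * rho (indicator (ball y R))"
    using weak_doubling_ratio_near_1[OF bfn wd c] by metis
  \<comment> \<open>The bound \<open>Suc j\<close> makes \<open>1 / R j\<close> at most 1 and
    convergent to 0, as the kernel lemma demands.\<close>
  obtain R y where Ry: "\<And>j::nat. R j \<ge> real (Suc j)" "\<And>j. R j > 0"
    "\<And>j. rho (indicator (ball (y j) (s * R j))) \<le> ennreal c * rho (indicator (ball (y j) (R j)))"
    using s(2)[of "real (Suc j)" for j] by metis
  obtain \<psi> :: "'a \<Rightarrow> complex" where \<psi>: "elem_test \<psi>" "\<And>x. norm x \<le> 1 \<Longrightarrow> \<psi> x = 1"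
    "\<And>x. norm x \<ge> s \<Longrightarrow> \<psi> x = 0" "\<And>x. cmod (\<psi> x) \<le> 1"
    using cutoff_exists[OF s(1)] by metis
  obtain N :: nat where N: "\<sigma> \<le> real N" using real_arch_simple by blast
  let ?\<kappa> = "(2 * pi) powr (- real DIM('a))"
  have \<kappa>: "?\<kappa> > 0" by simp
  define \<epsilon> where "\<epsilon> j \<eta> = (\<integral>\<^sup>+\<zeta>. ennreal (cmod (a' ((1 / R j) *\<^sub>R \<zeta> + \<eta>) - a' \<eta>) * cmod (fourier \<psi> \<zeta>)) \<partial>lborel)" for j \<eta>
  have "AE \<eta> in lborel. liminf (\<lambda>j. \<epsilon> j \<eta>) = 0"
    unfolding \<epsilon>_def
  proof (rule AE_liminf_kernel_0[OF a' _ w N])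
    show "(\<lambda>\<zeta>. cmod (fourier \<psi> \<zeta>)) \<in> borel_measurable borel"
      using fourier_measurable[OF \<psi>(1)] by measurable
    show "integrable lborel (\<lambda>\<zeta>. (1 + norm \<zeta>) ^ N * cmod (fourier \<psi> \<zeta>))"
      by (rule fourier_integrable[OF \<psi>(1)])
    show "0 \<le> 1 / R j" for j using Ry(2)[of j] by simp
    have le: "1 / R j \<le> inverse (real (Suc j))" for j
      using Ry(1)[of j] Ry(2)[of j] by (simp add: divide_inverse le_imp_inverse_le del: of_nat_Suc)
    have "inverse (real (Suc j)) \<le> 1" for j by (simp add: divide_simps)
    then show "1 / R j \<le> 1" for j using le[of j] order_trans by blast
    show "(\<lambda>j. 1 / R j) \<longlonglongrightarrow> 0"
      by (rule tendsto_sandwich[OF _ _ tendsto_const LIMSEQ_inverse_real_of_nat])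
         (use Ry(2) le in \<open>auto intro!: always_eventually less_imp_le simp del: of_nat_Suc\<close>)
  qed simp
  then show ?thesis
  proof eventually_elim
    case (elim \<eta>)
    show "ennreal (cmod (a' \<eta>)) \<le> ennreal c * multiplier_norm rho a"
    proof (rule ennreal_le_epsilon)
      fix \<delta> :: real assume \<delta>: "0 < \<delta>"
      \<comment> \<open>If all averages were at least \<open>\<delta> / ?\<kappa>\<close>, so would
        be their lower limit, which is 0. Division by \<open>?\<kappa>\<close> anticipates the
        prefactor of the error estimate.\<close>
      have "\<exists>j. \<epsilon> j \<eta> < ennreal (\<delta> / ?\<kappa>)"
      proof (rule ccontr)
        assume "\<not> ?thesis"
        then have "ennreal (\<delta> / ?\<kappa>) \<le> liminf (\<lambda>j. \<epsilon> j \<eta>)"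
          by (intro Liminf_bounded always_eventually) (auto simp: not_less)
        with elim divide_pos_pos[OF \<delta> \<kappa>] show False by (simp only: le_zero_eq ennreal_eq_0_iff not_le[symmetric])
      qed
      then obtain j where "\<epsilon> j \<eta> < ennreal (\<delta> / ?\<kappa>)" ..
      then have "ennreal ?\<kappa> * \<epsilon> j \<eta> \<le> ennreal ?\<kappa> * ennreal (\<delta> / ?\<kappa>)"
        by (intro mult_left_mono) auto
      also have "\<dots> = ennreal \<delta>" using \<kappa> \<delta> by (simp flip: ennreal_mult)
      finally have "ennreal ?\<kappa> * \<epsilon> j \<eta> \<le> ennreal \<delta>" .
      then have "ennreal (cmod (a' \<eta>) - \<delta>) * rho (indicator (ball (y j) (R j))) \<le>
          multiplier_norm rho a * rho (indicator (ball (y j) (s * R j)))"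
        unfolding \<epsilon>_def using \<delta>
        by (intro multiplier_pointwise_bound[OF bfn a a' ae w \<psi> Ry(2)]) auto
      also have "\<dots> \<le> multiplier_norm rho a * (ennreal c * rho (indicator (ball (y j) (R j))))"
        by (intro mult_left_mono Ry(3)) simp
      finally have "rho (indicator (ball (y j) (R j))) * ennreal (cmod (a' \<eta>) - \<delta>) \<le>
          rho (indicator (ball (y j) (R j))) * (ennreal c * multiplier_norm rho a)"
        by (simp only: mult_ac)
      \<comment> \<open>The norm of the inner ball is positive and finite, so it cancels; only the
        factor \<open>c\<close> remains of the geometry.\<close>
      then have le: "ennreal (cmod (a' \<eta>) - \<delta>) \<le> ennreal c * multiplier_norm rho a"
        using bfn_ball_pos[OF bfn Ry(2), of "y j" j] bfn_ball_finite[OF bfn, of "y j" "R j"]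
        by (subst (asm) ennreal_mult_le_mult_iff) auto
      have "ennreal (cmod (a' \<eta>)) \<le> ennreal (cmod (a' \<eta>) - \<delta>) + ennreal \<delta>"
        by (cases "cmod (a' \<eta>) \<ge> \<delta>") (use \<delta> in \<open>auto simp: ennreal_neg ennreal_leI simp flip: ennreal_plus\<close>)
      also have "\<dots> \<le> ennreal c * multiplier_norm rho a + ennreal \<delta>"
        by (intro add_right_mono le)
      finally show "ennreal (cmod (a' \<eta>)) \<le> ennreal c * multiplier_norm rho a + ennreal \<delta>" .
    qed
  qed
qed

text \<open>Expressions such as \<open>a' (r *\<^sub>R \<zeta> + \<eta>)\<close> must be jointly
  measurable for Tonelli, which a Borel representative guarantees.\<close>

lemma lebesgue_ex_borel_measurable_complex:
  fixes a :: "'a::euclidean_space \<Rightarrow> complex"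
  assumes [measurable]: "a \<in> borel_measurable lebesgue"
  obtains a' where "a' \<in> borel_measurable borel" "AE \<xi> in lborel. a \<xi> = a' \<xi>"
proof -
  obtain f where f[measurable]: "f \<in> borel_measurable lborel" "AE \<xi> in lborel. Re (a \<xi>) = f \<xi>"
    using completion_ex_borel_measurable_real[of "\<lambda>\<xi>. Re (a \<xi>)" lborel] by auto
  obtain g where g[measurable]: "g \<in> borel_measurable lborel" "AE \<xi> in lborel. Im (a \<xi>) = g \<xi>"
    using completion_ex_borel_measurable_real[of "\<lambda>\<xi>. Im (a \<xi>)" lborel] by auto
  have [measurable]: "f \<in> borel_measurable borel" "g \<in> borel_measurable borel" using f(1) g(1) by simp_all
  have "(\<lambda>\<xi>. complex_of_real (f \<xi>) + \<i> * complex_of_real (g \<xi>)) \<in> borel_measurable borel" by measurable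
  moreover from f(2) g(2) have "AE \<xi> in lborel. a \<xi> = complex_of_real (f \<xi>) + \<i> * complex_of_real (g \<xi>)"
    by eventually_elim (simp add: complex_eq_iff)
  ultimately show ?thesis by (rule that)
qed

theorem theorem4p1:
  fixes rho :: "('a::euclidean_space \<Rightarrow> ennreal) \<Rightarrow> ennreal"
    and a :: "'a \<Rightarrow> complex" and \<sigma> :: real
  assumes "banach_function_norm rho"
    and "weak_doubling rho"
    and "a \<in> L1_sigma \<sigma>"
    and "multiplier_norm rho a < \<infinity>"
  shows "esssup lebesgue (\<lambda>\<xi>. ereal (cmod (a \<xi>))) < \<infinity> \<and>
         esssup lebesgue (\<lambda>\<xi>. ereal (cmod (a \<xi>))) \<le> enn2ereal (multiplier_norm rho a)"
proof -
  let ?M = "multiplier_norm rho a"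
  have a[measurable]: "a \<in> borel_measurable lebesgue"
    and w: "(\<integral>\<^sup>+\<xi>. ennreal ((1 + norm \<xi>) powr (- \<sigma>) * cmod (a \<xi>)) \<partial>lebesgue) < \<infinity>"
    using assms(3) by (auto simp: L1_sigma_def)
  obtain a' where a': "a' \<in> borel_measurable borel" and ae: "AE \<xi> in lborel. a \<xi> = a' \<xi>"
    using lebesgue_ex_borel_measurable_complex[OF a] by metis
  have "(\<integral>\<^sup>+\<xi>. ennreal ((1 + norm \<xi>) powr (- \<sigma>) * cmod (a' \<xi>)) \<partial>lborel) =
      (\<integral>\<^sup>+\<xi>. ennreal ((1 + norm \<xi>) powr (- \<sigma>) * cmod (a \<xi>)) \<partial>lborel)"
    using ae by (intro nn_integral_cong_AE) auto
  with w have w': "(\<integral>\<^sup>+\<xi>. ennreal ((1 + norm \<xi>) powr (- \<sigma>) * cmod (a' \<xi>)) \<partial>lborel) < \<infinity>"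
    by (simp add: nn_integral_completion)
  have ae': "AE \<xi> in lebesgue. a \<xi> = a' \<xi>" using ae by (rule AE_completion)
  \<comment> \<open>The exceptional set depends on \<open>c\<close>; a sequence of values
    \<open>c > 1\<close> tending to 1 keeps their union null.\<close>
  have "AE \<xi> in lborel. \<forall>k::nat. ennreal (cmod (a' \<xi>)) \<le> ennreal (1 + inverse (real (Suc k))) * ?M"
    unfolding AE_all_countable
    by (intro allI AE_le_multiplier_norm_times[OF assms(1,2) a a' ae' w']) simp
  with ae have "AE \<xi> in lborel. ennreal (cmod (a \<xi>)) \<le> ?M"
  proof eventually_elim
    case (elim \<xi>)
    \<comment> \<open>Finiteness of \<open>?M\<close> makes multiplication by it continuous, so the
      bound survives the limit \<open>c = 1\<close>.\<close>
    have "(\<lambda>k. ?M * ennreal (1 + inverse (real (Suc k)))) \<longlonglongrightarrow> ?M * ennreal (1 + 0)"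
      using assms(4) by (intro ennreal_tendsto_cmult tendsto_ennrealI tendsto_add tendsto_const
          LIMSEQ_inverse_real_of_nat) simp
    from LIMSEQ_le_const[OF this, of "ennreal (cmod (a' \<xi>))"] elim show ?case by (simp add: mult.commute)
  qed
  then have "AE \<xi> in lebesgue. ennreal (cmod (a \<xi>)) \<le> ?M" by (rule AE_completion)
  then have "AE \<xi> in lebesgue. ereal (cmod (a \<xi>)) \<le> enn2ereal ?M"
    by eventually_elim (simp add: less_eq_ennreal.rep_eq enn2ereal_ennreal)
  then have "esssup lebesgue (\<lambda>\<xi>. ereal (cmod (a \<xi>))) \<le> enn2ereal ?M"
    by (intro esssup_I) measurable
  moreover have "enn2ereal ?M < \<infinity>" using assms(4) by (simp add: less_ennreal.rep_eq)
  ultimately show ?thesis by (auto intro: order.strict_trans1)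
qed

end
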